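(* Assume that the processes $N_{\cdot,T}$ and $W_\cdot$ are independent; that $\sigma^2(\cdot)$ is deterministic, lies in the Hölder class $\mathcal C^{m,\gamma}[0,1]$ for some $m\in\{0,1,2\}$ and $0<\gamma<1$, and is bounded away from zero uniformly; and that $\lambda(\cdot)$ is deterministic, lies in the Hölder class $\mathcal C^{m',\gamma'}[0,1]$ for some $m'\in\{0,1,2\}$ and $0<\gamma'<1$, and is bounded away from zero uniformly. Let $u_o\in(0,1)$ and $$\widehat\lambda(u_o):=\frac1{\mathfrak b T}\sum_{i=1}^{N_T}\mathfrak K\Big(\frac{t_i-u_oT}{\mathfrak bT}\Big),$$ where the bandwidth $\mathfrak b=\mathfrak b(T)$ satisfies $\mathfrak b\to0$ and $\mathfrak bT\to\infty$ as $T\to\infty$, and $\mathfrak K:\mathbb R\to\mathbb R^+$ is a continuous symmetric function with $\mathfrak K(x)=0$ for $|x|\ge1$ and $\int_{\mathbb R}\mathfrak K(x)\,dx=1$. Then, as $T\to\infty$, $\widehat\lambda(u_o)\to\lambda(u_o)$ in probability and $$\sqrt{\mathfrak bT}\big(\widehat\lambda(u_o)-\mathbb E\widehat\lambda(u_o)\big)\xrightarrow{\mathcal D}\mathcal N\Big(0,\lambda(u_o)\int_{\mathbb R}\mathfrak K^2(x)\,dx\Big).$$ Moreover, if $\mathfrak b^{2(m'+\gamma')+1}T=o(1)$, then $$\sqrt{\mathfrak bT}\Big(\mathbb E\widehat\lambda(u_o)-\lambda(u_o)-\frac{\mathfrak b^2}2\lambda^{(2)}(u_o)\int_{\mathbb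 R}x^2\mathfrak K(x)\,dx\cdot I_{\{m'=2\}}\Big)=o_p(1),$$ and in particular $$\sqrt{\mathfrak bT}\Big(\widehat\lambda(u_o)-\lambda(u_o)-\frac{\mathfrak b^2}2\lambda^{(2)}(u_o)\int_{\mathbb R}x^2\mathfrak K(x)\,dx\cdot I_{\{m'=2\}}\Big)\xrightarrow{\mathcal D}\mathcal N\Big(0,\lambda(u_o)\int_{\mathbb R}\mathfrak K^2(x)\,dx\Big).$$
   Context: For each $T>0$, $N_{t,T}$, $t\in[0,T]$, is a nonhomogeneous Poisson process with continuous non-negative intensity function $t\mapsto\lambda(t/T)$, where $\lambda:[0,1]\to\mathbb R$. Its arrival times are $t_i=t_{i,T}:=\inf\{t:N_{t,T}\ge i\}$, and $N_T:=N_{T,T}$. The log-price is $dX_{t,T}=\sigma(t/T)\,T^{-1/2}\,dW_{N_{t,T}}$ on $[0,T]$, with $W$ a standard Brownian motion and $\sigma^2(\cdot)$ a continuous function on $[0,1]$. A function $f$ is in the Hölder class $\mathcal C^{m,\gamma}[0,1]$ ($m\ge0$ an integer, $0<\gamma<1$) if $f$ is $m$ times differentiable and $|f^{(m)}(x+\delta)-f^{(m)}(x)|\le C|\delta|^\gamma$ for $|\delta|\to0$ and a constant $C$. $I_{\{\cdot\}}$ is the indicator; $f^{(k)}$ the $k$-th derivative; a term multiplied by a vanishing indicator is read as $0$. *)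

theory Defs
  imports "HOL-Probability.Probability"
begin

text \<open>The \<open>k\<close>-th derivative of a function on \<open>[0,1]\<close>; at the end points the derivatives
  are one-sided. Values of \<open>f\<close> outside \<open>[0,1]\<close> are irrelevant.\<close>

definition deriv01 :: "nat \<Rightarrow> (real \<Rightarrow> real) \<Rightarrow> real \<Rightarrow> real" where
  "deriv01 k f = ((\<lambda>g x. vector_derivative g (at x within {0..1})) ^^ k) f"

text \<open>The Hoelder condition ``for \<open>\<bar>\<delta>\<bar> \<rightarrow> 0\<close>'' is read uniformly in \<open>x\<close>.\<close>

definition hoelder01 :: "nat \<Rightarrow> real \<Rightarrow> (real \<Rightarrow> real) \<Rightarrow> bool" where
  "hoelder01 m \<gamma> f \<longleftrightarrow>
     (\<forall>k<m. deriv01 k f differentiable_on {0..1}) \<and>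
     (\<exists>C. \<exists>\<delta>\<^sub>0>0. \<forall>x\<in>{0..1}. \<forall>\<delta>. \<bar>\<delta>\<bar> < \<delta>\<^sub>0 \<longrightarrow> x + \<delta> \<in> {0..1} \<longrightarrow>
        \<bar>deriv01 m f (x + \<delta>) - deriv01 m f x\<bar> \<le> C * \<bar>\<delta>\<bar> powr \<gamma>)"

definition bounded_away_from_zero01 :: "(real \<Rightarrow> real) \<Rightarrow> bool" where
  "bounded_away_from_zero01 f \<longleftrightarrow> (\<exists>c>0. \<forall>u\<in>{0..1}. c \<le> f u)"

text \<open>Nonhomogeneous Poisson process on \<open>[0,T]\<close> with intensity function \<open>r\<close>. The Poisson
  probabilities are written out because the library's \<^const>\<open>poisson_pmf\<close> requires a
  strictly positive mean. Paths are nondecreasing, so the subtraction on \<^typ>\<open>nat\<close> in the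
  increments does not truncate.\<close>

definition poisson_process :: "'a measure \<Rightarrow> real \<Rightarrow> (real \<Rightarrow> real) \<Rightarrow> (real \<Rightarrow> 'a \<Rightarrow> nat) \<Rightarrow> bool" where
  "poisson_process M T r N \<longleftrightarrow>
     (\<forall>t\<in>{0..T}. N t \<in> measurable M (count_space UNIV)) \<and>
     (\<forall>\<omega>\<in>space M. N 0 \<omega> = 0 \<and> mono_on {0..T} (\<lambda>t. N t \<omega>) \<and>
        (\<forall>t\<in>{0..<T}. continuous (at_right t) (\<lambda>s. real (N s \<omega>)))) \<and>
     (\<forall>s t k. 0 \<le> s \<longrightarrow> s \<le> t \<longrightarrow> t \<le> T \<longrightarrow>
        measure M {\<omega> \<in> space M. N t \<omega> - N s \<omega> = k} =
          (LBINT v:{s..t}. r v) ^ k / fact k * exp (- (LBINT v:{s..t}. r v))) \<and>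
     (\<forall>(n::nat) \<tau>. 0 \<le> \<tau> 0 \<longrightarrow> (\<forall>j<n. \<tau> j \<le> \<tau> (Suc j)) \<longrightarrow> \<tau> n \<le> T \<longrightarrow>
        prob_space.indep_vars M (\<lambda>_. count_space UNIV)
          (\<lambda>j \<omega>. N (\<tau> (Suc j)) \<omega> - N (\<tau> j) \<omega>) {..<n})"

definition brownian_motion :: "'a measure \<Rightarrow> (real \<Rightarrow> 'a \<Rightarrow> real) \<Rightarrow> bool" where
  "brownian_motion M W \<longleftrightarrow>
     (\<forall>t\<ge>0. W t \<in> borel_measurable M) \<and>
     (AE \<omega> in M. W 0 \<omega> = 0 \<and> continuous_on {0..} (\<lambda>t. W t \<omega>)) \<and>
     (\<forall>s t. 0 \<le> s \<longrightarrow> s < t \<longrightarrow>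
        distributed M lborel (\<lambda>\<omega>. W t \<omega> - W s \<omega>) (normal_density 0 (sqrt (t - s)))) \<and>
     (\<forall>(n::nat) \<tau>. 0 \<le> \<tau> 0 \<longrightarrow> (\<forall>j<n. \<tau> j \<le> \<tau> (Suc j)) \<longrightarrow>
        prob_space.indep_vars M (\<lambda>_. borel) (\<lambda>j \<omega>. W (\<tau> (Suc j)) \<omega> - W (\<tau> j) \<omega>) {..<n})"

text \<open>The process \<open>N\<close> on \<open>[0,T]\<close> and the process \<open>W\<close> on \<open>[0,\<infinity>)\<close> are independent as
  random elements of the product spaces, i.e. the generated sigma-algebras are independent.\<close>

definition independent_processes ::
    "'a measure \<Rightarrow> real \<Rightarrow> (real \<Rightarrow> 'a \<Rightarrow> nat) \<Rightarrow> (real \<Rightarrow> 'a \<Rightarrow> real) \<Rightarrow> bool" where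
  "independent_processes M T N W \<longleftrightarrow>
     prob_space.indep_var M
       (PiM {0..T} (\<lambda>_. count_space UNIV)) (\<lambda>\<omega>. \<lambda>t\<in>{0..T}. N t \<omega>)
       (PiM {0..} (\<lambda>_. borel)) (\<lambda>\<omega>. \<lambda>t\<in>{0..}. W t \<omega>)"

text \<open>Only used for \<open>1 \<le> i \<le> N T \<omega>\<close>, when the set is nonempty.\<close>

definition arrival_time :: "real \<Rightarrow> (real \<Rightarrow> 'a \<Rightarrow> nat) \<Rightarrow> nat \<Rightarrow> 'a \<Rightarrow> real" where
  "arrival_time T N i \<omega> = Inf {t \<in> {0..T}. i \<le> N t \<omega>}"

text \<open>\<open>dX\<^sub>t = \<sigma>(t/T) T\<^sup>-\<^sup>1\<^sup>/\<^sup>2 dW(N\<^sub>t)\<close> on \<open>[0,T]\<close>. The integrator is a step function that moves from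
  \<open>W(i-1)\<close> to \<open>W(i)\<close> at the \<open>i\<close>-th arrival time, so the integral is the finite sum below.\<close>

definition log_price ::
    "'a measure \<Rightarrow> real \<Rightarrow> (real \<Rightarrow> real) \<Rightarrow> (real \<Rightarrow> 'a \<Rightarrow> nat) \<Rightarrow> (real \<Rightarrow> 'a \<Rightarrow> real)
      \<Rightarrow> (real \<Rightarrow> 'a \<Rightarrow> real) \<Rightarrow> bool" where
  "log_price M T \<sigma> N W X \<longleftrightarrow>
     (\<forall>t\<in>{0..T}. X t \<in> borel_measurable M) \<and>
     (AE \<omega> in M. \<forall>t\<in>{0..T}. X t \<omega> = X 0 \<omega> +
        (\<Sum>i=1..N t \<omega>. \<sigma> (arrival_time T N i \<omega> / T) * T powr (-1/2) *
           (W (real i) \<omega> - W (real i - 1) \<omega>)))"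

definition intensity_estimator ::
    "(real \<Rightarrow> real) \<Rightarrow> real \<Rightarrow> real \<Rightarrow> (real \<Rightarrow> 'a \<Rightarrow> nat) \<Rightarrow> real \<Rightarrow> 'a \<Rightarrow> real" where
  "intensity_estimator K b T N u \<omega> =
     1 / (b * T) * (\<Sum>i=1..N T \<omega>. K ((arrival_time T N i \<omega> - u * T) / (b * T)))"

definition converges_in_probability ::
    "'a measure \<Rightarrow> ('i \<Rightarrow> 'a \<Rightarrow> real) \<Rightarrow> real \<Rightarrow> 'i filter \<Rightarrow> bool" where
  "converges_in_probability M Y c F \<longleftrightarrow>
     (\<forall>\<^sub>F i in F. Y i \<in> borel_measurable M) \<and>
     (\<forall>\<epsilon>>0. ((\<lambda>i. measure M {\<omega> \<in> space M. \<epsilon> < \<bar>Y i \<omega> - c\<bar>}) \<longlongrightarrow> 0) F)"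

text \<open>The library's \<^const>\<open>weak_conv_m\<close> covers only sequences; this is the same notion along
  an arbitrary filter.\<close>

definition converges_in_distribution ::
    "'a measure \<Rightarrow> ('i \<Rightarrow> 'a \<Rightarrow> real) \<Rightarrow> real measure \<Rightarrow> 'i filter \<Rightarrow> bool" where
  "converges_in_distribution M Y L F \<longleftrightarrow>
     (\<forall>\<^sub>F i in F. Y i \<in> borel_measurable M) \<and>
     (\<forall>x. isCont (cdf L) x \<longrightarrow> ((\<lambda>i. cdf (distr M borel (Y i)) x) \<longlongrightarrow> cdf L x) F)"

text \<open>\<^const>\<open>normal_density\<close> is parametrised by the standard deviation.\<close>

definition normal_law :: "real \<Rightarrow> real \<Rightarrow> real measure" where
  "normal_law \<mu> v = density lborel (normal_density \<mu> (sqrt v))"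

end

theory Submission
  imports Defs
begin

text \<open>Let \<open>S = \<Sum>\<^sub>i g(t\<^sub>i)\<close> be the sum of a continuous function over the arrival times of a
  Poisson process with intensity \<open>r\<close>. It is the pointwise limit of the Riemann sums of \<open>g\<close> against
  the increments of the process, so independence of the increments yields Campbell's formulas
  \<open>E S = \<integral> r g\<close> and \<open>E exp(i S) = exp(\<integral> r (exp(i g) - 1))\<close>. Rescaling time around \<open>u T\<close> turns these
  into integrals over \<open>[-1,1]\<close>, and dominated convergence together with Levy's continuity theorem
  gives both consistency (limit law a point mass) and the central limit theorem. A deterministic
  shift \<open>c(T) \<rightarrow> 0\<close> is carried along in the latter, which absorbs the bias without Slutsky's theorem;
  the bias itself is a Taylor expansion in which the symmetry of the kernel kills the linear term.\<close>

section \<open>Poisson random variables\<close>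

text \<open>All the asymptotics rest on one exact formula. With \<open>q = sqrt (b T * T)\<close>,
  the characteristic function at \<theta> of \<open>q\<close> times the centred estimator is the
  exponential of the integral over [-1,1] of \<open>lam (u + b T * x)\<close> times q^2 (exp(iy/q) -
  1 - iy/q), where y = \<theta> K(x). Centring removes exactly the linear term of the exponential,
  since the mean of the estimator is the integral of \<open>lam (u + b T * x) * K x\<close>. The
  second factor tends to -y^2/2 and is bounded by y^2/2, so neither a Lindeberg condition nor a
  moment beyond the first has to be checked. Without centring, and with q^2 as the scale instead of
  q, the linear term is what survives; this gives consistency. The obstacle is that arrival times
  are infima over paths, whereas laws and independence are given only for increments over
  deterministic time points; hence the detour through Riemann sums. Moreover the formula is
  available only once the window of half-width \<open>b T\<close> around \<open>u\<close> lies in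
  [0,1], so measurability and the identities are carried as statements about all sufficiently large
  \<open>T\<close>.\<close>

lemma (in prob_space) nat_valued_expectation:
  fixes f :: "nat \<Rightarrow> 'b::{banach, second_countable_topology}"
  assumes Y[measurable]: "Y \<in> measurable M (count_space UNIV)"
    and summable: "summable (\<lambda>k. norm (f k) * measure M {\<omega> \<in> space M. Y \<omega> = k})"
  shows "integrable M (\<lambda>\<omega>. f (Y \<omega>))"
    and "(\<lambda>k. measure M {\<omega> \<in> space M. Y \<omega> = k} *\<^sub>R f k) sums expectation (\<lambda>\<omega>. f (Y \<omega>))"
proof -
  \<comment> \<open>At a fixed outcome only the term with \<open>k = Y \<omega>\<close> is nonzero,
    so the pointwise series are trivial. The exchange of series and expectation then needs only
    summable expected norms, which is the hypothesis in disguise.\<close>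
  define h where "h = (\<lambda>k \<omega>. indicator {\<omega> \<in> space M. Y \<omega> = k} \<omega> *\<^sub>R f k)"
  have int: "integrable M (h k)" for k
    unfolding h_def by (intro integrable_scaleR_left integrable_real_indicator) (auto simp: emeasure_eq_measure)
  have single: "(\<lambda>k. h k \<omega>) sums f (Y \<omega>)" if "\<omega> \<in> space M" for \<omega>
  proof -
    have "(\<lambda>k. h k \<omega>) = (\<lambda>k. if k = Y \<omega> then f k else 0)"
      using that by (auto simp: h_def)
    then show ?thesis by (simp add: sums_single)
  qed
  have norm_single: "summable (\<lambda>k. norm (h k \<omega>))" if "\<omega> \<in> space M" for \<omega>
  proof -
    have "(\<lambda>k. norm (h k \<omega>)) = (\<lambda>k. if k = Y \<omega> then norm (f k) else 0)"
      using that by (auto simp: h_def)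
    then show ?thesis using sums_single[THEN sums_summable, of "Y \<omega>" "\<lambda>k. norm (f k)"] by simp
  qed
  have ev: "expectation (\<lambda>\<omega>. indicator {\<omega> \<in> space M. Y \<omega> = k} \<omega> *\<^sub>R c)
      = measure M {\<omega> \<in> space M. Y \<omega> = k} *\<^sub>R c" for k and c :: "'c::{banach, second_countable_topology}"
    by (subst integral_scaleR_left) (auto simp: emeasure_eq_measure)
  have "(\<lambda>\<omega>. norm (h k \<omega>)) = (\<lambda>\<omega>. indicator {\<omega> \<in> space M. Y \<omega> = k} \<omega> *\<^sub>R norm (f k))" for k
    by (auto simp: h_def)
  then have sumint: "summable (\<lambda>k. expectation (\<lambda>\<omega>. norm (h k \<omega>)))"
    using summable by (simp add: ev mult.commute del: real_scaleR_def) (simp add: mult.commute)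
  have ae: "AE \<omega> in M. summable (\<lambda>k. norm (h k \<omega>))"
    using norm_single by auto
  have suminf: "(\<Sum>k. h k \<omega>) = f (Y \<omega>)" if "\<omega> \<in> space M" for \<omega>
    using single[OF that] by (simp add: sums_iff)
  show "integrable M (\<lambda>\<omega>. f (Y \<omega>))"
    using integrable_suminf[OF int ae sumint] suminf
    by (simp cong: Bochner_Integration.integrable_cong)
  show "(\<lambda>k. measure M {\<omega> \<in> space M. Y \<omega> = k} *\<^sub>R f k) sums expectation (\<lambda>\<omega>. f (Y \<omega>))"
    using sums_integral[OF int ae sumint] suminf
    by (simp add: h_def ev cong: Bochner_Integration.integral_cong)
qed

text \<open>Both expectations are exponential series: for the mean the term at 0 vanishes and the
  factor \<open>Suc k\<close> cancels against \<open>fact (Suc k)\<close>; for the characteristic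
  function \<open>iexp (\<theta> * real k)\<close> is a k-th power and merges with
  \<open>\<Lambda> ^ k\<close>.\<close>

lemma (in prob_space) poisson_moments:
  assumes Y[measurable]: "Y \<in> measurable M (count_space UNIV)"
    and law: "\<And>k. measure M {\<omega> \<in> space M. Y \<omega> = k} = \<Lambda> ^ k / fact k * exp (- \<Lambda>)"
  shows "integrable M (\<lambda>\<omega>. real (Y \<omega>))" "expectation (\<lambda>\<omega>. real (Y \<omega>)) = \<Lambda>"
    and "expectation (\<lambda>\<omega>. iexp (\<theta> * real (Y \<omega>))) = exp (of_real \<Lambda> * (iexp \<theta> - 1))"
proof -
  have e: "(\<lambda>k. \<Lambda> ^ k / fact k) sums exp \<Lambda>"
    using exp_converges[of \<Lambda>] by (simp add: field_simps)
  have mean: "(\<lambda>k. real k * (\<Lambda> ^ k / fact k * exp (- \<Lambda>))) sums \<Lambda>"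
  proof (rule sums_Suc_imp)
    have "real (Suc k) * (\<Lambda> ^ Suc k / fact (Suc k) * exp (- \<Lambda>)) = \<Lambda> * exp (- \<Lambda>) * (\<Lambda> ^ k / fact k)" for k
      by (simp add: field_simps del: of_nat_Suc)
    with sums_mult[OF e, of "\<Lambda> * exp (- \<Lambda>)"]
    show "(\<lambda>k. real (Suc k) * (\<Lambda> ^ Suc k / fact (Suc k) * exp (- \<Lambda>))) sums \<Lambda>"
      by (simp only: mult.assoc) (simp add: exp_minus)
  next
    show "real 0 * (\<Lambda> ^ 0 / fact 0 * exp (- \<Lambda>)) = 0" by simp
  qed
  have summ: "summable (\<lambda>k. norm (real k) * measure M {\<omega> \<in> space M. Y \<omega> = k})"
    using mean[THEN sums_summable] by (simp add: law)
  show "integrable M (\<lambda>\<omega>. real (Y \<omega>))"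
    by (rule nat_valued_expectation[OF Y summ])
  show "expectation (\<lambda>\<omega>. real (Y \<omega>)) = \<Lambda>"
    using nat_valued_expectation(2)[OF Y summ] mean
    by (simp add: law sums_iff mult_ac)
  have summ': "summable (\<lambda>k. norm (iexp (\<theta> * real k)) * measure M {\<omega> \<in> space M. Y \<omega> = k})"
    using sums_mult2[OF e, of "exp (- \<Lambda>)"] by (simp add: law sums_iff)
  have "iexp (\<theta> * real k) = iexp \<theta> ^ k" for k
    by (simp add: exp_of_nat_mult[symmetric] mult_ac)
  moreover have "complex_of_real (exp (- \<Lambda>)) = exp (- of_real \<Lambda>)"
    using exp_of_real[of "- \<Lambda>", where 'a=complex] by (simp only: of_real_minus)
  ultimately have "measure M {\<omega> \<in> space M. Y \<omega> = k} *\<^sub>R iexp (\<theta> * real k)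
      = exp (- of_real \<Lambda>) * ((of_real \<Lambda> * iexp \<theta>) ^ k /\<^sub>R fact k)" for k
    by (simp only: law scaleR_conv_of_real of_real_mult of_real_divide of_real_power of_real_fact
        of_real_inverse power_mult_distrib) (simp only: divide_inverse mult_ac)
  moreover have "(\<lambda>k. exp (- of_real \<Lambda>) * ((of_real \<Lambda> * iexp \<theta>) ^ k /\<^sub>R fact k))
      sums (exp (- of_real \<Lambda>) * exp (of_real \<Lambda> * iexp \<theta>))"
    by (intro sums_mult exp_converges)
  ultimately have "expectation (\<lambda>\<omega>. iexp (\<theta> * real (Y \<omega>)))
      = exp (- of_real \<Lambda>) * exp (of_real \<Lambda> * iexp \<theta>)"
    using nat_valued_expectation(2)[OF Y summ'] by (simp only: sums_iff)
  then show "expectation (\<lambda>\<omega>. iexp (\<theta> * real (Y \<omega>))) = exp (of_real \<Lambda> * (iexp \<theta> - 1))"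
    by (simp only: exp_add[symmetric]) (simp add: right_diff_distrib)
qed

section \<open>Riemann sums for sums over arrival times\<close>

text \<open>Regroups arrivals by time cell: with \<open>a j\<close> the count up to the j-th
  partition point, the indices in \<open>{a j<..a (Suc j)}\<close> are those of the arrivals in the
  j-th cell.\<close>

lemma sum_consecutive_intervals:
  fixes a :: "nat \<Rightarrow> nat" and f :: "nat \<Rightarrow> 'b::comm_monoid_add"
  assumes "\<And>j. j < n \<Longrightarrow> a j \<le> a (Suc j)"
  shows "(\<Sum>j<n. \<Sum>i\<in>{a j<..a (Suc j)}. f i) = (\<Sum>i\<in>{a 0<..a n}. f i)"
  using assms
proof (induction n)
  case (Suc n)
  have "a 0 \<le> a j" if "j \<le> n" for j
    using that Suc.prems by (induction j) (auto intro: le_trans simp: less_Suc_eq)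
  then have "{a 0<..a (Suc n)} = {a 0<..a n} \<union> {a n<..a (Suc n)}"
    using Suc.prems[of n] by (force intro: le_trans)
  then show ?case
    using Suc by (simp add: sum.union_disjoint ivl_disj_int)
qed simp

text \<open>The infimum defining an arrival time is attained, so locating the i-th arrival becomes a
  question about the counts at deterministic times.\<close>

lemma arrival_time_le_iff:
  assumes "0 < T" and pp: "poisson_process M T r N" and \<omega>: "\<omega> \<in> space M"
    and i: "1 \<le> i" "i \<le> N T \<omega>" and t: "t \<in> {0..T}"
  shows "arrival_time T N i \<omega> \<le> t \<longleftrightarrow> i \<le> N t \<omega>"
    and "arrival_time T N i \<omega> \<in> {0..T}"
proof -
  define A where "A = {t \<in> {0..T}. i \<le> N t \<omega>}"
  have mono: "mono_on {0..T} (\<lambda>t. N t \<omega>)"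
    and rc: "\<And>t. t \<in> {0..<T} \<Longrightarrow> continuous (at_right t) (\<lambda>s. real (N s \<omega>))"
    using pp \<omega> unfolding poisson_process_def by auto
  have T: "T \<in> A" using i \<open>0 < T\<close> by (auto simp: A_def)
  have bdd: "bdd_below A" by (auto simp: A_def)
  have arr: "arrival_time T N i \<omega> = Inf A" by (simp add: arrival_time_def A_def)
  have "0 \<le> Inf A"
    using T by (intro cInf_greatest) (auto simp: A_def)
  then have range: "Inf A \<in> {0..T}"
    using cInf_lower[OF T bdd] by simp
  then show "arrival_time T N i \<omega> \<in> {0..T}" by (simp add: arr)
  \<comment> \<open>Every point to the right of the infimum lies above some element of
    \<open>A\<close>, so the count there is at least \<open>i\<close>, and right-continuity passes
    this to the infimum itself. Right-continuity is available only below \<open>T\<close>, but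
    \<open>T\<close> belongs to \<open>A\<close> anyway.\<close>
  have "Inf A \<in> A"
  proof (cases "Inf A = T")
    case False
    then have lt: "Inf A < T" using range by auto
    have "((\<lambda>s. real (N s \<omega>)) \<longlongrightarrow> real (N (Inf A) \<omega>)) (at_right (Inf A))"
      using rc[of "Inf A"] range lt by (auto simp: continuous_within)
    moreover have "eventually (\<lambda>s. real i \<le> real (N s \<omega>)) (at_right (Inf A))"
    proof (rule eventually_at_rightI[OF _ lt])
      fix s assume s: "s \<in> {Inf A<..<T}"
      then obtain a where "a \<in> A" "a < s"
        using cInf_lessD[of A s] T by auto
      then show "real i \<le> real (N s \<omega>)"
        using mono_onD[OF mono, of a s] s by (auto simp: A_def)
    qed
    ultimately have "real i \<le> real (N (Inf A) \<omega>)"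
      by (rule tendsto_lowerbound) simp
    then show ?thesis using range by (simp add: A_def)
  qed (use T in simp)
  then show "arrival_time T N i \<omega> \<le> t \<longleftrightarrow> i \<le> N t \<omega>"
    unfolding arr using cInf_lower[of t A] bdd mono_onD[OF mono range t] t
    by (fastforce simp: A_def)
qed

lemma uniform_partition:
  assumes "0 < T" "0 < (n::nat)" "j < n"
  shows "real j * T / n \<in> {0..T}" "real (Suc j) * T / n \<in> {0..T}" "real j * T / n \<le> real (Suc j) * T / n"
    "real (Suc j) * T / n - real j * T / n = T / n"
proof -
  have "real (Suc j) \<le> real n" using \<open>j < n\<close> by simp
  then show "real (Suc j) * T / n \<in> {0..T}"
    using assms by (simp add: divide_le_eq mult.commute[of T] mult_right_mono del: of_nat_Suc)
  show "real j * T / n \<in> {0..T}"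
    using assms by (simp add: divide_le_eq mult.commute[of T] mult_right_mono)
qed (use assms in \<open>auto simp: field_simps\<close>)

text \<open>Each arrival is moved to the left end of its cell, which changes its term by at most the
  oscillation of \<open>g\<close> on a cell. A path has only \<open>N T \<omega>\<close> arrivals,
  so the total error vanishes with the mesh.\<close>

lemma arrival_sum_riemann:
  fixes g :: "real \<Rightarrow> real"
  assumes "0 < T" and pp: "poisson_process M T r N" and \<omega>: "\<omega> \<in> space M"
    and g: "continuous_on {0..T} g"
  shows "(\<lambda>n. \<Sum>j<n. g (real j * T / n) * real (N (real (Suc j) * T / n) \<omega> - N (real j * T / n) \<omega>))
    \<longlonglongrightarrow> (\<Sum>i=1..N T \<omega>. g (arrival_time T N i \<omega>))"
proof (rule LIMSEQ_I)
  fix e :: real assume "0 < e"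
  \<comment> \<open>The extra 1 keeps the divisor positive on paths without arrivals and makes the
    final estimate strict.\<close>
  define m where "m = real (N T \<omega>) + 1"
  have "m > 0" by (simp add: m_def)
  have "uniformly_continuous_on {0..T} g"
    using g by (rule compact_uniformly_continuous) simp
  then obtain d where "d > 0" and d: "\<And>s t. s \<in> {0..T} \<Longrightarrow> t \<in> {0..T} \<Longrightarrow> \<bar>t - s\<bar> < d \<Longrightarrow> \<bar>g t - g s\<bar> < e / m"
    using \<open>0 < e\<close> \<open>m > 0\<close> unfolding uniformly_continuous_on_def dist_real_def
    by (metis divide_pos_pos)
  obtain n0 :: nat where n0: "T / d < n0" using reals_Archimedean2 by blast
  have mono: "mono_on {0..T} (\<lambda>t. N t \<omega>)" and N0: "N 0 \<omega> = 0"
    using pp \<omega> unfolding poisson_process_def by auto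
  show "\<exists>n0. \<forall>n\<ge>n0. norm ((\<Sum>j<n. g (real j * T / n) * real (N (real (Suc j) * T / n) \<omega> - N (real j * T / n) \<omega>))
      - (\<Sum>i=1..N T \<omega>. g (arrival_time T N i \<omega>))) < e"
  proof (intro exI[of _ "Suc n0"] allI impI)
    fix n assume n: "Suc n0 \<le> n"
    then have "n > 0" by simp
    have small: "T / n < d"
    proof -
      have "T / d < n" using n0 n by linarith
      then show ?thesis using \<open>d > 0\<close> \<open>n > 0\<close> by (simp add: field_simps)
    qed
    define \<tau> where "\<tau> j = real j * T / n" for j
    define a where "a j = N (\<tau> j) \<omega>" for j
    define f where "f i = g (arrival_time T N i \<omega>)" for i
    note part = uniform_partition[OF \<open>0 < T\<close> \<open>n > 0\<close>, folded \<tau>_def]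
    have a_mono: "a j \<le> a (Suc j)" if "j < n" for j
      unfolding a_def using part[OF that] by (intro mono_onD[OF mono])
    have ends: "a 0 = 0" "a n = N T \<omega>"
      using \<open>n > 0\<close> N0 by (auto simp: a_def \<tau>_def)
    have a_le: "a j \<le> N T \<omega>" if "j \<le> n" for j
      unfolding a_def using that \<open>0 < T\<close> \<open>n > 0\<close>
      by (intro mono_onD[OF mono]) (auto simp: \<tau>_def field_simps)
    have close: "\<bar>g (\<tau> j) - f i\<bar> \<le> e / m" if "j < n" "i \<in> {a j<..a (Suc j)}" for i j
    proof -
      have i: "1 \<le> i" "i \<le> N T \<omega>" using that a_le[of "Suc j"] by auto
      note arr = arrival_time_le_iff[OF \<open>0 < T\<close> pp \<omega> i]
      have "\<tau> j < arrival_time T N i \<omega>" "arrival_time T N i \<omega> \<le> \<tau> (Suc j)"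
        using arr(1)[OF part(1)[OF that(1)]] arr(1)[OF part(2)[OF that(1)]] that(2)
        by (auto simp: a_def)
      then have "\<bar>g (\<tau> j) - g (arrival_time T N i \<omega>)\<bar> < e / m"
        using part(4)[OF that(1)] small
        by (intro d part(1)[OF that(1)] arr(2)[of T]) (use \<open>0 < T\<close> in auto)
      then show ?thesis by (simp add: f_def)
    qed
    have "(\<Sum>i=1..N T \<omega>. f i) = (\<Sum>i\<in>{a 0<..a n}. f i)"
      by (rule sum.cong) (auto simp: ends)
    also have "\<dots> = (\<Sum>j<n. \<Sum>i\<in>{a j<..a (Suc j)}. f i)"
      using sum_consecutive_intervals[of n a f] a_mono by simp
    \<comment> \<open>\<open>real (a (Suc j) - a j)\<close> is the number of indices in the j-th
      block, so \<open>g (\<tau> j)\<close> can be moved inside as a constant summand.\<close>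
    finally have "(\<Sum>j<n. g (\<tau> j) * real (a (Suc j) - a j)) - (\<Sum>i=1..N T \<omega>. f i)
        = (\<Sum>j<n. \<Sum>i\<in>{a j<..a (Suc j)}. g (\<tau> j) - f i)"
      by (simp add: sum_subtractf mult.commute)
    also have "\<bar>\<dots>\<bar> \<le> (\<Sum>j<n. \<Sum>i\<in>{a j<..a (Suc j)}. e / m)"
      by (intro order.trans[OF sum_abs] sum_mono order.trans[OF sum_abs]) (use close in auto)
    also have "\<dots> = (\<Sum>i\<in>{a 0<..a n}. e / m)"
      using sum_consecutive_intervals[of n a "\<lambda>_. e / m"] a_mono by simp
    also have "\<dots> = real (N T \<omega>) * (e / m)" by (simp add: ends)
    also have "\<dots> < e" using \<open>0 < e\<close> \<open>m > 0\<close> by (simp add: m_def field_simps)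
    finally show "norm ((\<Sum>j<n. g (real j * T / n) * real (N (real (Suc j) * T / n) \<omega> - N (real j * T / n) \<omega>))
      - (\<Sum>i=1..N T \<omega>. g (arrival_time T N i \<omega>))) < e"
      by (simp add: \<tau>_def a_def f_def)
  qed
qed

section \<open>Deterministic Riemann sums weighted by the intensity\<close>

lemma sum_consecutive_integrals:
  fixes f :: "real \<Rightarrow> 'b::euclidean_space"
  assumes "\<And>j. j < n \<Longrightarrow> \<tau> j \<le> \<tau> (Suc j)" "f integrable_on {\<tau> 0..\<tau> n}"
  shows "(\<Sum>j<n. integral {\<tau> j..\<tau> (Suc j)} f) = integral {\<tau> 0..\<tau> n} f"
  using assms
proof (induction n)
  case (Suc n)
  have "\<tau> 0 \<le> \<tau> j" if "j \<le> n" for j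
    using that Suc.prems(1) by (induction j) (auto intro: order_trans simp: less_Suc_eq)
  then have *: "\<tau> 0 \<le> \<tau> n" "\<tau> n \<le> \<tau> (Suc n)" using Suc.prems(1) by auto
  then have "f integrable_on {\<tau> 0..\<tau> n}"
    using integrable_on_subinterval[OF Suc.prems(2)] by auto
  then show ?case
    using Suc Henstock_Kurzweil_Integration.integral_combine[OF * Suc.prems(2)] by simp
qed simp

text \<open>The weights are the exact Poisson means of the increments, so only \<open>h\<close> is
  discretised and the error is at most its oscillation on a cell times the total mass of
  \<open>r\<close>. The vector-valued form covers both the real \<open>g\<close> of the mean and the
  complex \<open>iexp (g t) - 1\<close> of the characteristic function.\<close>

lemma riemann_stieltjes_convergence:
  fixes h :: "real \<Rightarrow> 'b::euclidean_space"
  assumes "0 < T" and r: "continuous_on {0..T} r" "\<And>t. t \<in> {0..T} \<Longrightarrow> 0 \<le> r t"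
    and h: "continuous_on {0..T} h"
  shows "(\<lambda>n. \<Sum>j<n. integral {real j * T / n..real (Suc j) * T / n} r *\<^sub>R h (real j * T / n))
    \<longlonglongrightarrow> integral {0..T} (\<lambda>t. r t *\<^sub>R h t)"
proof (rule LIMSEQ_I)
  fix e :: real assume "0 < e"
  define m where "m = integral {0..T} r + 1"
  have r_int: "r integrable_on {0..T}"
    by (intro integrable_continuous_interval r)
  have "0 \<le> integral {0..T} r" 
    by (intro integral_nonneg r_int r)
  then have "m > 0" by (simp add: m_def)
  have "uniformly_continuous_on {0..T} h"
    using h by (rule compact_uniformly_continuous) simp
  then obtain d where "d > 0" and d: "\<And>s t. s \<in> {0..T} \<Longrightarrow> t \<in> {0..T} \<Longrightarrow> \<bar>t - s\<bar> < d \<Longrightarrow> norm (h t - h s) < e / m"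
    using \<open>0 < e\<close> \<open>m > 0\<close> unfolding uniformly_continuous_on_def dist_real_def dist_norm
    by (metis divide_pos_pos)
  obtain n0 :: nat where n0: "T / d < n0" using reals_Archimedean2 by blast
  show "\<exists>n0. \<forall>n\<ge>n0. norm ((\<Sum>j<n. integral {real j * T / n..real (Suc j) * T / n} r *\<^sub>R h (real j * T / n))
      - integral {0..T} (\<lambda>t. r t *\<^sub>R h t)) < e"
  proof (intro exI[of _ "Suc n0"] allI impI)
    fix n assume n: "Suc n0 \<le> n"
    then have "n > 0" by simp
    have small: "T / n < d"
    proof -
      have "T / d < n" using n0 n by linarith
      then show ?thesis using \<open>d > 0\<close> \<open>n > 0\<close> by (simp add: field_simps)
    qed
    define \<tau> where "\<tau> j = real j * T / n" for j
    note part = uniform_partition[OF \<open>0 < T\<close> \<open>n > 0\<close>, folded \<tau>_def]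
    have ends: "\<tau> 0 = 0" "\<tau> n = T" using \<open>n > 0\<close> by (auto simp: \<tau>_def)
    have rh: "continuous_on {0..T} (\<lambda>t. r t *\<^sub>R h t)" by (intro continuous_intros r h)
    have sub: "{\<tau> j..\<tau> (Suc j)} \<subseteq> {0..T}" if "j < n" for j
      using part[OF that] by auto
    have ints: "r integrable_on {\<tau> j..\<tau> (Suc j)}" "(\<lambda>t. r t *\<^sub>R h t) integrable_on {\<tau> j..\<tau> (Suc j)}"
      if "j < n" for j
      using continuous_on_subset[OF r(1) sub[OF that]] continuous_on_subset[OF rh sub[OF that]]
      by (auto intro: integrable_continuous_interval)
    have cell: "norm (integral {\<tau> j..\<tau> (Suc j)} r *\<^sub>R h (\<tau> j) - integral {\<tau> j..\<tau> (Suc j)} (\<lambda>t. r t *\<^sub>R h t))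
        \<le> integral {\<tau> j..\<tau> (Suc j)} r * (e / m)" if "j < n" for j
    proof -
      have *: "((\<lambda>t. r t *\<^sub>R h (\<tau> j) - r t *\<^sub>R h t) has_integral
          (integral {\<tau> j..\<tau> (Suc j)} r *\<^sub>R h (\<tau> j) - integral {\<tau> j..\<tau> (Suc j)} (\<lambda>t. r t *\<^sub>R h t))) {\<tau> j..\<tau> (Suc j)}"
        by (intro has_integral_diff has_integral_scaleR_left integrable_integral ints[OF that])
      have "norm (integral {\<tau> j..\<tau> (Suc j)} (\<lambda>t. r t *\<^sub>R h (\<tau> j) - r t *\<^sub>R h t))
          \<le> integral {\<tau> j..\<tau> (Suc j)} (\<lambda>t. r t * (e / m))"
      proof (rule integral_norm_bound_integral)
        fix t assume t: "t \<in> {\<tau> j..\<tau> (Suc j)}"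
        then have "norm (h (\<tau> j) - h t) \<le> e / m"
          using part[OF that] small sub[OF that] by (intro less_imp_le d) auto
        then have "r t * norm (h (\<tau> j) - h t) \<le> r t * (e / m)"
          using r(2)[of t] t sub[OF that] by (intro mult_left_mono) auto
        then show "norm (r t *\<^sub>R h (\<tau> j) - r t *\<^sub>R h t) \<le> r t * (e / m)"
          using r(2)[of t] t sub[OF that] by (auto simp flip: scaleR_diff_right)
      qed (rule has_integral_integrable[OF *], rule integrable_on_mult_left[OF ints(1)[OF that]])
      with * show ?thesis by (simp add: integral_unique)
    qed
    have "(\<Sum>j<n. integral {\<tau> j..\<tau> (Suc j)} (\<lambda>t. r t *\<^sub>R h t)) = integral {0..T} (\<lambda>t. r t *\<^sub>R h t)"
      using sum_consecutive_integrals[of n \<tau> "\<lambda>t. r t *\<^sub>R h t"] part(3) rh 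
      by (auto simp: ends intro: integrable_continuous_interval)
    then have "norm ((\<Sum>j<n. integral {\<tau> j..\<tau> (Suc j)} r *\<^sub>R h (\<tau> j)) - integral {0..T} (\<lambda>t. r t *\<^sub>R h t))
        = norm (\<Sum>j<n. integral {\<tau> j..\<tau> (Suc j)} r *\<^sub>R h (\<tau> j) - integral {\<tau> j..\<tau> (Suc j)} (\<lambda>t. r t *\<^sub>R h t))"
      by (simp add: sum_subtractf)
    also have "\<dots> \<le> (\<Sum>j<n. integral {\<tau> j..\<tau> (Suc j)} r * (e / m))"
      by (intro order.trans[OF norm_sum] sum_mono cell) simp
    also have "\<dots> = integral {0..T} r * (e / m)"
      using sum_consecutive_integrals[of n \<tau> r] part(3) r_int
      by (simp only: ends flip: sum_distrib_right)
    also have "\<dots> < e" using \<open>0 < e\<close> \<open>m > 0\<close> by (simp add: m_def field_simps)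
    finally show "norm ((\<Sum>j<n. integral {real j * T / n..real (Suc j) * T / n} r *\<^sub>R h (real j * T / n))
      - integral {0..T} (\<lambda>t. r t *\<^sub>R h t)) < e"
      by (simp add: \<tau>_def)
  qed
qed

section \<open>Campbell's formulas\<close>

text \<open>Restates the law of an increment with the gauge integral, the one used for the Riemann
  sums; for a continuous intensity it agrees with the Lebesgue integral.\<close>

lemma poisson_processD:
  assumes pp: "poisson_process M T r N" and st: "0 \<le> s" "s \<le> t" "t \<le> T"
    and r: "continuous_on {0..T} r"
  shows "(\<lambda>\<omega>. N t \<omega> - N s \<omega>) \<in> measurable M (count_space UNIV)"
    and "measure M {\<omega> \<in> space M. N t \<omega> - N s \<omega> = k} = integral {s..t} r ^ k / fact k * exp (- integral {s..t} r)"
proof -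
  have m: "N t \<in> measurable M (count_space UNIV)" "N s \<in> measurable M (count_space UNIV)"
    using pp st unfolding poisson_process_def by auto
  from this[measurable] show "(\<lambda>\<omega>. N t \<omega> - N s \<omega>) \<in> measurable M (count_space UNIV)"
    by measurable
  have "(LBINT v:{s..t}. r v) = integral {s..t} r"
    using continuous_on_subset[OF r] st
    by (intro set_borel_integral_eq_integral borel_integrable_atLeastAtMost') auto
  then show "measure M {\<omega> \<in> space M. N t \<omega> - N s \<omega> = k} = integral {s..t} r ^ k / fact k * exp (- integral {s..t} r)"
    using pp st by (simp add: poisson_process_def)
qed

lemma (in prob_space) poisson_process_functional:
  fixes g :: "real \<Rightarrow> real"
  assumes "0 < T" and pp: "poisson_process M T r N"
    and r: "continuous_on {0..T} r" "\<And>t. t \<in> {0..T} \<Longrightarrow> 0 \<le> r t"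
    and g: "continuous_on {0..T} g"
  defines "S \<equiv> \<lambda>\<omega>. \<Sum>i=1..N T \<omega>. g (arrival_time T N i \<omega>)"
  shows "S \<in> borel_measurable M" and "integrable M S"
    and "expectation S = integral {0..T} (\<lambda>t. r t * g t)"
    and "expectation (\<lambda>\<omega>. iexp (S \<omega>)) = exp (integral {0..T} (\<lambda>t. r t *\<^sub>R (iexp (g t) - 1)))"
proof -
  define \<tau> where "\<tau> n j = real j * T / real n" for n j
  define \<Delta> where "\<Delta> n j \<omega> = N (\<tau> n (Suc j)) \<omega> - N (\<tau> n j) \<omega>" for n j \<omega>
  define \<Lambda> where "\<Lambda> n j = integral {\<tau> n j..\<tau> n (Suc j)} r" for n j
  define R where "R n \<omega> = (\<Sum>j<n. g (\<tau> n j) * real (\<Delta> n j \<omega>))" for n \<omega>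
  have part: "0 \<le> \<tau> n j" "\<tau> n j \<le> \<tau> n (Suc j)" "\<tau> n (Suc j) \<le> T" "\<tau> n j \<in> {0..T}" if "j < n" for n j
    using uniform_partition[OF \<open>0 < T\<close> _ that] that by (auto simp: \<tau>_def)
  have meas: "\<Delta> n j \<in> measurable M (count_space UNIV)" if "j < n" for n j
    unfolding \<Delta>_def using poisson_processD(1)[OF pp part(1-3)[OF that] r(1)] .
  have law: "measure M {\<omega> \<in> space M. \<Delta> n j \<omega> = k} = \<Lambda> n j ^ k / fact k * exp (- \<Lambda> n j)" if "j < n" for n j k
    unfolding \<Delta>_def \<Lambda>_def using poisson_processD(2)[OF pp part(1-3)[OF that] r(1)] .
  note moments = poisson_moments[OF meas law]
  have R_meas: "R n \<in> borel_measurable M" for n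
    unfolding R_def
    by (intro borel_measurable_sum borel_measurable_times borel_measurable_const
        measurable_compose[OF meas]) auto
  have R_lim: "(\<lambda>n. R n \<omega>) \<longlonglongrightarrow> S \<omega>" if "\<omega> \<in> space M" for \<omega>
    using arrival_sum_riemann[OF \<open>0 < T\<close> pp that g] by (simp add: R_def \<tau>_def \<Delta>_def S_def)
  show S_meas: "S \<in> borel_measurable M"
    using R_lim R_meas by (rule borel_measurable_LIMSEQ_real)

  have "bounded (g ` {0..T})"
    by (intro compact_imp_bounded compact_continuous_image g) simp
  then obtain B where "\<forall>t\<in>{0..T}. \<bar>g t\<bar> \<le> B"
    unfolding bounded_iff by (auto simp only: ball_simps real_norm_def)
  then have B: "\<And>t. t \<in> {0..T} \<Longrightarrow> \<bar>g t\<bar> \<le> B" by blast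
  have NT: "integrable M (\<lambda>\<omega>. real (N T \<omega>))"
  proof -
    have N0: "N 0 \<omega> = 0" if "\<omega> \<in> space M" for \<omega>
      using pp that unfolding poisson_process_def by auto
    have "integrable M (\<lambda>\<omega>. real (N T \<omega> - N 0 \<omega>))"
      using poisson_processD[OF pp, of 0 T] r \<open>0 < T\<close>
      by (intro poisson_moments(1)[where \<Lambda> = "integral {0..T} r"]) auto
    then show ?thesis using N0 by (simp cong: Bochner_Integration.integrable_cong)
  qed
  \<comment> \<open>Paths are monotone, so the absolute increments telescope to
    \<open>N T \<omega>\<close>; this gives one integrable bound for all \<open>n\<close>. The case
    \<open>n = 0\<close> is separate because there all partition points collapse to 0 and the
    telescoped sum does not end at \<open>T\<close>.\<close>
  have R_bound: "\<bar>R n \<omega>\<bar> \<le> B * real (N T \<omega>)" if \<omega>: "\<omega> \<in> space M" for n \<omega>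
  proof (cases "n = 0")
    case True
    then show ?thesis using B[of 0] \<open>0 < T\<close> by (simp add: R_def)
  next
    case False
    have mono: "mono_on {0..T} (\<lambda>t. N t \<omega>)" and N0: "N 0 \<omega> = 0"
      using pp \<omega> unfolding poisson_process_def by auto
    have "\<bar>R n \<omega>\<bar> \<le> (\<Sum>j<n. B * (real (N (\<tau> n (Suc j)) \<omega>) - real (N (\<tau> n j) \<omega>)))"
      unfolding R_def
    proof (intro order.trans[OF sum_abs] sum_mono)
      fix j assume "j \<in> {..<n}"
      then have j: "j < n" by simp
      have "N (\<tau> n j) \<omega> \<le> N (\<tau> n (Suc j)) \<omega>"
        using part[OF j] by (intro mono_onD[OF mono]) auto
      then show "\<bar>g (\<tau> n j) * real (\<Delta> n j \<omega>)\<bar> \<le> B * (real (N (\<tau> n (Suc j)) \<omega>) - real (N (\<tau> n j) \<omega>))"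
        using B[OF part(4)[OF j]] by (auto simp: abs_mult \<Delta>_def of_nat_diff intro!: mult_right_mono)
    qed
    also have "\<dots> = B * real (N T \<omega>)"
      using False N0
      by (subst sum_distrib_left[symmetric], subst sum_lessThan_telescope) (simp add: \<tau>_def)
    finally show ?thesis .
  qed
  have dom: "integrable M (\<lambda>\<omega>. B * real (N T \<omega>))" using NT by simp
  show "integrable M S"
    by (rule integrable_dominated_convergence[where s = R, OF S_meas R_meas dom]) (use R_lim R_bound in auto)
  have "(\<lambda>n. expectation (R n)) \<longlonglongrightarrow> expectation S"
    by (rule integral_dominated_convergence[where s = R, OF S_meas R_meas dom]) (use R_lim R_bound in auto)
  moreover have "expectation (R n) = (\<Sum>j<n. \<Lambda> n j *\<^sub>R g (\<tau> n j))" for n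
    unfolding R_def by (subst Bochner_Integration.integral_sum)
      (auto simp: moments mult.commute)
  moreover have "(\<lambda>n. \<Sum>j<n. \<Lambda> n j *\<^sub>R g (\<tau> n j)) \<longlonglongrightarrow> integral {0..T} (\<lambda>t. r t *\<^sub>R g t)"
    unfolding \<Lambda>_def \<tau>_def by (rule riemann_stieltjes_convergence[OF \<open>0 < T\<close> r g])
  ultimately show "expectation S = integral {0..T} (\<lambda>t. r t * g t)"
    by (simp add: LIMSEQ_unique)

  have lim: "(\<lambda>n. expectation (\<lambda>\<omega>. iexp (R n \<omega>))) \<longlonglongrightarrow> expectation (\<lambda>\<omega>. iexp (S \<omega>))"
  proof (rule integral_dominated_convergence[where w = "\<lambda>_. 1"])
    show "AE \<omega> in M. (\<lambda>n. iexp (R n \<omega>)) \<longlonglongrightarrow> iexp (S \<omega>)"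
      using R_lim by (auto intro!: tendsto_intros)
  qed (use S_meas R_meas in auto)
  \<comment> \<open>\<open>char\<close> at 1 is the expectation of \<open>iexp\<close>, so the
    product rule for characteristic functions of independent sums turns the independent increments
    into a product of exponentials, that is, a Riemann sum in the exponent.\<close>
  have factor: "expectation (\<lambda>\<omega>. iexp (R n \<omega>)) = exp (\<Sum>j<n. \<Lambda> n j *\<^sub>R (iexp (g (\<tau> n j)) - 1))" for n
  proof (cases "n = 0")
    case False
    have ends: "0 \<le> \<tau> n 0" "\<tau> n n \<le> T"
      using False by (auto simp: \<tau>_def)
    have "indep_vars (\<lambda>_. count_space UNIV) (\<Delta> n) {..<n}"
      unfolding \<Delta>_def using pp ends part(2)
      unfolding poisson_process_def by (elim conjE allE[of _ n] allE[of _ "\<tau> n"]) simp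
    then have ind: "indep_vars (\<lambda>_. borel) (\<lambda>j \<omega>. g (\<tau> n j) * real (\<Delta> n j \<omega>)) {..<n}"
      by (rule indep_vars_compose2[where Y = "\<lambda>j k. g (\<tau> n j) * real k"]) auto
    have "expectation (\<lambda>\<omega>. iexp (R n \<omega>)) = char (distr M borel (R n)) 1"
      using R_meas by (simp add: char_def integral_distr)
    also have "\<dots> = (\<Prod>j<n. char (distr M borel (\<lambda>\<omega>. g (\<tau> n j) * real (\<Delta> n j \<omega>))) 1)"
      unfolding R_def by (rule char_distr_sum[OF ind])
    also have "\<dots> = (\<Prod>j<n. exp (\<Lambda> n j *\<^sub>R (iexp (g (\<tau> n j)) - 1)))"
    proof (rule prod.cong[OF refl])
      fix j assume "j \<in> {..<n}"
      then have j: "j < n" by simp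
      have "(\<lambda>\<omega>. g (\<tau> n j) * real (\<Delta> n j \<omega>)) \<in> borel_measurable M"
        by (intro borel_measurable_times borel_measurable_const measurable_compose[OF meas[OF j]]) auto
      then have "char (distr M borel (\<lambda>\<omega>. g (\<tau> n j) * real (\<Delta> n j \<omega>))) 1
          = expectation (\<lambda>\<omega>. iexp (g (\<tau> n j) * real (\<Delta> n j \<omega>)))"
        by (simp add: char_def integral_distr)
      also have "\<dots> = exp (\<Lambda> n j *\<^sub>R (iexp (g (\<tau> n j)) - 1))"
        unfolding moments(3)[OF j j] scaleR_conv_of_real ..
      finally show "char (distr M borel (\<lambda>\<omega>. g (\<tau> n j) * real (\<Delta> n j \<omega>))) 1
          = exp (\<Lambda> n j *\<^sub>R (iexp (g (\<tau> n j)) - 1))" .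
    qed
    finally show ?thesis by (simp add: exp_sum)
  qed (simp add: R_def prob_space)
  have "(\<lambda>n. \<Sum>j<n. \<Lambda> n j *\<^sub>R (iexp (g (\<tau> n j)) - 1)) \<longlonglongrightarrow> integral {0..T} (\<lambda>t. r t *\<^sub>R (iexp (g t) - 1))"
    unfolding \<Lambda>_def \<tau>_def
    by (rule riemann_stieltjes_convergence[OF \<open>0 < T\<close> r]) (assumption, intro continuous_intros g)
  then have "(\<lambda>n. expectation (\<lambda>\<omega>. iexp (R n \<omega>))) \<longlonglongrightarrow> exp (integral {0..T} (\<lambda>t. r t *\<^sub>R (iexp (g t) - 1)))"
    unfolding factor by (rule tendsto_exp)
  with lim show "expectation (\<lambda>\<omega>. iexp (S \<omega>)) = exp (integral {0..T} (\<lambda>t. r t *\<^sub>R (iexp (g t) - 1)))"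
    by (rule LIMSEQ_unique)
qed

text \<open>The substitution is t = uT + bTx. The bounds \<open>b \<le> u\<close> and
  \<open>b \<le> 1 - u\<close> keep the whole window inside [0,T], so no part of the kernel is cut
  off at the boundary. The function \<open>h\<close> is generic because it stands both for the
  kernel and for \<open>iexp\<close> of the scaled kernel minus 1.\<close>

lemma integral_rescale_kernel:
  fixes h :: "real \<Rightarrow> 'b::euclidean_space"
  assumes "0 < T" "0 < b" "b \<le> u" "b \<le> 1 - u"
    and lam: "continuous_on {0..1} lam" and h: "continuous_on UNIV h"
    and supp: "\<And>x. 1 \<le> \<bar>x\<bar> \<Longrightarrow> h x = 0"
  shows "integral {0..T} (\<lambda>t. lam (t / T) *\<^sub>R h ((t - u * T) / (b * T)))
    = (b * T) *\<^sub>R (LBINT x:{-1..1}. lam (u + b * x) *\<^sub>R h x)"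
proof -
  have pos: "b * T > 0" using assms by simp
  have "continuous_on {0..T} (\<lambda>t. lam (t / T) *\<^sub>R h ((t - u * T) / (b * T)))"
    using \<open>0 < T\<close> pos
    by (intro continuous_on_scaleR continuous_on_compose2[OF lam] continuous_on_compose2[OF h] continuous_intros)
      (auto simp: field_simps)
  then have "integral {0..T} (\<lambda>t. lam (t / T) *\<^sub>R h ((t - u * T) / (b * T)))
    = (LBINT t:{0..T}. lam (t / T) *\<^sub>R h ((t - u * T) / (b * T)))"
    by (intro set_borel_integral_eq_integral(2)[symmetric] borel_integrable_atLeastAtMost') auto
  also have "\<dots> = (b * T) *\<^sub>R (LBINT x. indicator {0..T} (u * T + b * T * x) *\<^sub>R
      (lam ((u * T + b * T * x) / T) *\<^sub>R h ((u * T + b * T * x - u * T) / (b * T))))"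
    unfolding set_lebesgue_integral_def
    by (subst lborel_integral_real_affine[where c = "b * T" and t = "u * T"])
      (use pos in \<open>simp_all only: abs_of_pos less_imp_neq[OF pos, symmetric] not_False_eq_True\<close>)
  also have "(LBINT x. indicator {0..T} (u * T + b * T * x) *\<^sub>R
      (lam ((u * T + b * T * x) / T) *\<^sub>R h ((u * T + b * T * x - u * T) / (b * T))))
      = (LBINT x:{-1..1}. lam (u + b * x) *\<^sub>R h x)"
    unfolding set_lebesgue_integral_def
  proof (intro Bochner_Integration.integral_cong refl)
    fix x :: real
    have "(u * T + b * T * x) / T = u + b * x" "(u * T + b * T * x - u * T) / (b * T) = x"
      using \<open>0 < T\<close> \<open>0 < b\<close> by (auto simp: field_simps)
    moreover have "u * T + b * T * x \<in> {0..T}" if "x \<in> {-1..1}"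
    proof -
      have "b * x \<le> b * 1" "b * (-1) \<le> b * x" using that \<open>0 < b\<close> by (auto simp only: mult_le_cancel_left_pos atLeastAtMost_iff)
      then have "0 \<le> (u + b * x) * T" "(u + b * x) * T \<le> 1 * T"
        using \<open>0 < T\<close> \<open>b \<le> u\<close> \<open>b \<le> 1 - u\<close> by (auto intro!: mult_right_mono mult_nonneg_nonneg)
      then show ?thesis by (simp add: algebra_simps)
    qed
    moreover have "h x = 0" if "x \<notin> {-1..1}" using supp[of x] that by auto
    ultimately show "indicator {0..T} (u * T + b * T * x) *\<^sub>R
      (lam ((u * T + b * T * x) / T) *\<^sub>R h ((u * T + b * T * x - u * T) / (b * T)))
      = indicator {-1..1} x *\<^sub>R (lam (u + b * x) *\<^sub>R h x)"
      by (auto simp: indicator_def)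
  qed
  finally show ?thesis .
qed

section \<open>Convergence through characteristic functions\<close>

text \<open>A limit along the reals follows from the limits along all sequences tending to infinity,
  and Levy's theorem handles each of these.\<close>

lemma (in prob_space) converges_in_distribution_if_char:
  fixes Y :: "real \<Rightarrow> 'a \<Rightarrow> real"
  assumes meas: "\<forall>\<^sub>F T in at_top. Y T \<in> borel_measurable M"
    and L: "real_distribution L"
    and char: "\<And>\<theta>. ((\<lambda>T. expectation (\<lambda>\<omega>. iexp (\<theta> * Y T \<omega>))) \<longlongrightarrow> char L \<theta>) at_top"
  shows "converges_in_distribution M Y L at_top"
  unfolding converges_in_distribution_def
proof (intro conjI meas allI impI)
  fix x assume x: "isCont (cdf L) x"
  show "((\<lambda>T. cdf (distr M borel (Y T)) x) \<longlongrightarrow> cdf L x) at_top"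
  proof (rule tendsto_at_topI_sequentially)
    fix X :: "nat \<Rightarrow> real" assume X: "filterlim X at_top sequentially"
    \<comment> \<open>\<open>Y T\<close> is measurable only for large \<open>T\<close>, while every
      member of a sequence of laws must be a probability measure. Early non-measurable members are
      replaced by 0, which leaves the limit unchanged.\<close>
    define Z where "Z n = (if Y (X n) \<in> borel_measurable M then Y (X n) else (\<lambda>_. 0))" for n
    have Z_meas: "Z n \<in> borel_measurable M" for n by (simp add: Z_def)
    have Z_eq: "\<forall>\<^sub>F n in sequentially. Z n = Y (X n)"
      using filterlim_iff[THEN iffD1, OF X, rule_format, OF meas]
      by eventually_elim (simp add: Z_def)
    have Z_char: "char (distr M borel (Z n)) \<theta> = expectation (\<lambda>\<omega>. iexp (\<theta> * Z n \<omega>))" for n \<theta>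
      using Z_meas[of n] by (simp add: char_def integral_distr)
    have "weak_conv_m (\<lambda>n. distr M borel (Z n)) L"
    proof (rule levy_continuity)
      fix \<theta>
      have "(\<lambda>n. expectation (\<lambda>\<omega>. iexp (\<theta> * Y (X n) \<omega>))) \<longlonglongrightarrow> char L \<theta>"
        by (rule filterlim_compose[OF char X])
      moreover have "\<forall>\<^sub>F n in sequentially. expectation (\<lambda>\<omega>. iexp (\<theta> * Y (X n) \<omega>)) = char (distr M borel (Z n)) \<theta>"
        using Z_eq by eventually_elim (unfold Z_char, simp)
      ultimately show "(\<lambda>n. char (distr M borel (Z n)) \<theta>) \<longlonglongrightarrow> char L \<theta>"
        by (rule Lim_transform_eventually)
    qed (use Z_meas L in auto)
    then have "(\<lambda>n. cdf (distr M borel (Z n)) x) \<longlonglongrightarrow> cdf L x"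
      using x by (simp add: weak_conv_m_def weak_conv_def)
    moreover have "\<forall>\<^sub>F n in sequentially. cdf (distr M borel (Z n)) x = cdf (distr M borel (Y (X n))) x"
      using Z_eq by eventually_elim simp
    ultimately show "(\<lambda>n. cdf (distr M borel (Y (X n))) x) \<longlonglongrightarrow> cdf L x"
      by (rule Lim_transform_eventually)
  qed
qed

text \<open>The law is the image of the standard normal law under scaling by \<open>sqrt v\<close>,
  so its characteristic function is the standard one at \<open>\<theta> * sqrt v\<close>.\<close>

lemma
  assumes "0 < v"
  shows real_distribution_normal_law: "real_distribution (normal_law \<mu> v)"
    and char_normal_law: "char (normal_law 0 v) \<theta> = exp (- of_real (v * \<theta>\<^sup>2 / 2))"
proof -
  have *: "real_distribution (normal_law \<mu> v)" for \<mu>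
    using prob_space_normal_density[of "sqrt v" \<mu>] assms
    by (auto simp: normal_law_def real_distribution_def real_distribution_axioms_def)
  then show "real_distribution (normal_law \<mu> v)" .
  interpret std: prob_space std_normal_distribution by (rule prob_space_normal_density) simp
  have "distributed std_normal_distribution lborel (\<lambda>x. x) std_normal_density"
    unfolding distributed_def by (auto simp: distr_id2)
  from std.normal_density_affine[OF this, of "sqrt v" 0] assms
  have "distributed std_normal_distribution lborel (\<lambda>x. sqrt v * x) (normal_density 0 (sqrt v))" by simp
  then have "normal_law 0 v = distr std_normal_distribution lborel (\<lambda>x. sqrt v * x)"
    by (simp add: distributed_def normal_law_def)
  then have "char (normal_law 0 v) \<theta> = char std_normal_distribution (\<theta> * sqrt v)"
    by (simp add: char_def integral_distr mult_ac)
  also have "\<dots> = of_real (exp (- (v * \<theta>\<^sup>2 / 2)))"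
    using assms by (simp add: char_std_normal_distribution power_mult_distrib mult_ac)
  also have "\<dots> = exp (- of_real (v * \<theta>\<^sup>2 / 2))"
    using exp_of_real[of "- (v * \<theta>\<^sup>2 / 2)", where 'a=complex] by (simp only: of_real_minus)
  finally show "char (normal_law 0 v) \<theta> = exp (- of_real (v * \<theta>\<^sup>2 / 2))" .
qed

text \<open>The cdf of the point mass jumps only at \<open>c\<close>, so the cdfs of
  \<open>Y T\<close> converge at \<open>c - \<epsilon>\<close> to 0 and at
  \<open>c + \<epsilon>\<close> to 1. Together these values bound the probability of a deviation
  larger than \<epsilon>.\<close>

lemma (in prob_space) converges_in_probability_if_char:
  fixes Y :: "real \<Rightarrow> 'a \<Rightarrow> real"
  assumes meas: "\<forall>\<^sub>F T in at_top. Y T \<in> borel_measurable M"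
    and char: "\<And>\<theta>. ((\<lambda>T. expectation (\<lambda>\<omega>. iexp (\<theta> * Y T \<omega>))) \<longlongrightarrow> iexp (\<theta> * c)) at_top"
  shows "converges_in_probability M Y c at_top"
  unfolding converges_in_probability_def
proof (intro conjI meas allI impI)
  let ?L = "return borel c :: real measure"
  have L: "real_distribution ?L"
    by (auto simp: real_distribution_def real_distribution_axioms_def prob_space_return)
  have "char ?L \<theta> = iexp (\<theta> * c)" for \<theta>
    unfolding char_def by (subst integral_return) auto
  then have conv: "converges_in_distribution M Y ?L at_top"
    using char by (intro converges_in_distribution_if_char meas L) simp
  have cdf_L: "cdf ?L x = of_bool (c \<le> x)" for x
    by (simp add: cdf_def measure_return)
  have cont: "isCont (cdf ?L) x" if "x \<noteq> c" for x
  proof -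
    have "\<forall>\<^sub>F y in nhds x. (c \<le> y) = (c \<le> x)"
    proof (cases "c < x")
      case True
      then have "\<forall>\<^sub>F y in nhds x. y \<in> {c<..}" by (intro eventually_nhds_in_open) auto
      then show ?thesis using True by (auto elim!: eventually_mono)
    next
      case False
      then have "\<forall>\<^sub>F y in nhds x. y \<in> {..<c}" using that by (intro eventually_nhds_in_open) auto
      then show ?thesis using False that by (auto elim!: eventually_mono)
    qed
    then have "\<forall>\<^sub>F y in nhds x. cdf ?L y = cdf ?L x"
      by eventually_elim (simp add: cdf_L)
    then show ?thesis
      using isCont_cong by fastforce
  qed
  fix \<epsilon> :: real assume "0 < \<epsilon>"
  have lim: "((\<lambda>T. cdf (distr M borel (Y T)) x) \<longlongrightarrow> of_bool (c \<le> x)) at_top" if "x \<noteq> c" for x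
    using conv cont[OF that] unfolding converges_in_distribution_def cdf_L by simp
  have "((\<lambda>T. cdf (distr M borel (Y T)) (c - \<epsilon>) + (1 - cdf (distr M borel (Y T)) (c + \<epsilon>))) \<longlongrightarrow>
     of_bool (c \<le> c - \<epsilon>) + (1 - of_bool (c \<le> c + \<epsilon>))) at_top"
    using \<open>0 < \<epsilon>\<close> by (intro tendsto_intros lim) auto
  then have upper: "((\<lambda>T. cdf (distr M borel (Y T)) (c - \<epsilon>) + (1 - cdf (distr M borel (Y T)) (c + \<epsilon>))) \<longlongrightarrow> 0) at_top"
    using \<open>0 < \<epsilon>\<close> by simp
  show "((\<lambda>T. measure M {\<omega> \<in> space M. \<epsilon> < \<bar>Y T \<omega> - c\<bar>}) \<longlongrightarrow> 0) at_top"
  proof (rule tendsto_sandwich[OF _ _ tendsto_const upper])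
    show "\<forall>\<^sub>F T in at_top. measure M {\<omega> \<in> space M. \<epsilon> < \<bar>Y T \<omega> - c\<bar>}
        \<le> cdf (distr M borel (Y T)) (c - \<epsilon>) + (1 - cdf (distr M borel (Y T)) (c + \<epsilon>))"
      using meas
    proof eventually_elim
      case (elim T)
      note [measurable] = elim
      have cdf_Y: "cdf (distr M borel (Y T)) x = measure M {\<omega> \<in> space M. Y T \<omega> \<le> x}" for x
        by (simp add: cdf_def measure_distr vimage_def Int_def conj_commute)
      have "measure M {\<omega> \<in> space M. \<epsilon> < \<bar>Y T \<omega> - c\<bar>}
          \<le> measure M ({\<omega> \<in> space M. Y T \<omega> \<le> c - \<epsilon>} \<union> (space M - {\<omega> \<in> space M. Y T \<omega> \<le> c + \<epsilon>}))"
        by (intro finite_measure_mono) auto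
      also have "\<dots> \<le> measure M {\<omega> \<in> space M. Y T \<omega> \<le> c - \<epsilon>} + measure M (space M - {\<omega> \<in> space M. Y T \<omega> \<le> c + \<epsilon>})"
        by (intro measure_Un_le) measurable
      also have "\<dots> = cdf (distr M borel (Y T)) (c - \<epsilon>) + (1 - cdf (distr M borel (Y T)) (c + \<epsilon>))"
        by (simp add: cdf_Y prob_compl)
      finally show ?case .
    qed
  qed simp
qed

section \<open>The kernel estimator\<close>

text \<open>A multiple of the estimator is again a sum of a continuous function over arrivals, so
  Campbell's formulas apply to it. The rescaling then applies because
  \<open>iexp (\<theta> * K x / (b * T)) - 1\<close> vanishes wherever \<open>K\<close>
  does.\<close>

lemma (in prob_space) intensity_estimator_moments:
  assumes "0 < T" and pp: "poisson_process M T (\<lambda>t. lam (t / T)) N"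
    and b: "0 < b" "b \<le> u" "b \<le> 1 - u"
    and lam: "continuous_on {0..1} lam" "\<And>x. x \<in> {0..1} \<Longrightarrow> 0 \<le> lam x"
    and K: "continuous_on UNIV K" "\<And>x. 1 \<le> \<bar>x\<bar> \<Longrightarrow> K x = 0"
  shows "intensity_estimator K b T N u \<in> borel_measurable M"
    and "expectation (intensity_estimator K b T N u) = (LBINT x:{-1..1}. lam (u + b * x) *\<^sub>R K x)"
    and "expectation (\<lambda>\<omega>. iexp (\<theta> * intensity_estimator K b T N u \<omega>))
      = exp ((b * T) *\<^sub>R (LBINT x:{-1..1}. lam (u + b * x) *\<^sub>R (iexp (\<theta> * K x / (b * T)) - 1)))"
proof -
  have pos: "b * T > 0" using assms by simp
  \<comment> \<open>The free factor \<open>c\<close> is \<open>1 / (b * T)\<close> for the mean and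
    \<open>\<theta> / (b * T)\<close> for the characteristic function.\<close>
  define g where "g c t = c * K ((t - u * T) / (b * T))" for c t
  have r: "continuous_on {0..T} (\<lambda>t. lam (t / T))" "\<And>t. t \<in> {0..T} \<Longrightarrow> 0 \<le> lam (t / T)"
    using \<open>0 < T\<close> by (auto intro!: continuous_on_compose2[OF lam(1)] continuous_intros lam(2))
  have g: "continuous_on {0..T} (g c)" for c
    unfolding g_def using pos by (intro continuous_intros continuous_on_compose2[OF K(1)]) auto
  note F = poisson_process_functional[OF \<open>0 < T\<close> pp r g]
  have est: "c * intensity_estimator K b T N u \<omega> = (\<Sum>i=1..N T \<omega>. g (c / (b * T)) (arrival_time T N i \<omega>))" for c \<omega>
    by (simp add: intensity_estimator_def g_def sum_distrib_left)
  have est1: "intensity_estimator K b T N u = (\<lambda>\<omega>. \<Sum>i=1..N T \<omega>. g (1 / (b * T)) (arrival_time T N i \<omega>))"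
    using est[of 1] by (simp add: fun_eq_iff)
  show "intensity_estimator K b T N u \<in> borel_measurable M"
    unfolding est1 by (rule F)
  have "expectation (intensity_estimator K b T N u) = integral {0..T} (\<lambda>t. lam (t / T) * g (1 / (b * T)) t)"
    unfolding est1 by (rule F)
  also have "\<dots> = (1 / (b * T)) * integral {0..T} (\<lambda>t. lam (t / T) *\<^sub>R K ((t - u * T) / (b * T)))"
    by (subst Henstock_Kurzweil_Integration.integral_mult_right[symmetric]) (simp add: g_def mult_ac)
  also have "\<dots> = (LBINT x:{-1..1}. lam (u + b * x) *\<^sub>R K x)"
    by (subst integral_rescale_kernel[OF \<open>0 < T\<close> b lam(1) K]) (use pos in auto)
  finally show "expectation (intensity_estimator K b T N u) = (LBINT x:{-1..1}. lam (u + b * x) *\<^sub>R K x)" .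
  have "expectation (\<lambda>\<omega>. iexp (\<theta> * intensity_estimator K b T N u \<omega>))
      = exp (integral {0..T} (\<lambda>t. lam (t / T) *\<^sub>R (iexp (g (\<theta> / (b * T)) t) - 1)))"
    unfolding est by (rule F)
  also have "integral {0..T} (\<lambda>t. lam (t / T) *\<^sub>R (iexp (g (\<theta> / (b * T)) t) - 1))
      = integral {0..T} (\<lambda>t. lam (t / T) *\<^sub>R (\<lambda>x. iexp (\<theta> * K x / (b * T)) - 1) ((t - u * T) / (b * T)))"
    by (simp add: g_def)
  also have "\<dots> = (b * T) *\<^sub>R (LBINT x:{-1..1}. lam (u + b * x) *\<^sub>R (iexp (\<theta> * K x / (b * T)) - 1))"
    by (rule integral_rescale_kernel[OF \<open>0 < T\<close> b lam(1)])
      (use K b \<open>0 < T\<close> in \<open>auto intro!: continuous_intros\<close>)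
  finally show "expectation (\<lambda>\<omega>. iexp (\<theta> * intensity_estimator K b T N u \<omega>))
      = exp ((b * T) *\<^sub>R (LBINT x:{-1..1}. lam (u + b * x) *\<^sub>R (iexp (\<theta> * K x / (b * T)) - 1)))" .
qed

text \<open>Freezes the intensity at \<open>u\<close> while the kernel factor converges under a
  uniform bound. The same passage to the limit serves consistency and the central limit theorem,
  with different \<open>H\<close>.\<close>

lemma tendsto_kernel_integral:
  fixes H :: "real \<Rightarrow> real \<Rightarrow> 'b::{banach, second_countable_topology}"
  assumes lam: "continuous_on {0..1} lam" and u: "0 < u" "u < 1"
    and b: "(b \<longlongrightarrow> 0) at_top"
    and H_meas: "\<And>T. H T \<in> borel_measurable borel" "H' \<in> borel_measurable borel"
    and H_bound: "\<forall>\<^sub>F T in at_top. \<forall>x\<in>{-1..1}. norm (H T x) \<le> B"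
    and H_lim: "\<And>x. x \<in> {-1..1} \<Longrightarrow> ((\<lambda>T. H T x) \<longlongrightarrow> H' x) at_top"
  shows "((\<lambda>T. LBINT x:{-1..1}. lam (u + b T * x) *\<^sub>R H T x) \<longlongrightarrow> (LBINT x:{-1..1}. lam u *\<^sub>R H' x)) at_top"
proof -
  \<comment> \<open>Extending \<open>lam\<close> beyond \<open>[0,1]\<close> makes the integrand measurable for every \<open>T\<close>, not just for large \<open>T\<close>.\<close>
  define l where "l x = lam (max 0 (min 1 x))" for x
  have l_cont: "continuous_on UNIV l"
    unfolding l_def by (intro continuous_on_compose2[OF lam] continuous_intros) auto
  have l_eq: "l x = lam x" if "x \<in> {0..1}" for x using that by (simp add: l_def)
  have "bounded (lam ` {0..1})"
    by (intro compact_imp_bounded compact_continuous_image lam) simp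
  then obtain A where A: "\<forall>x\<in>{0..1}. \<bar>lam x\<bar> \<le> A"
    unfolding bounded_iff by (auto simp only: ball_simps real_norm_def)
  have l_bound: "\<bar>l x\<bar> \<le> A" for x using A by (simp add: l_def)
  have l_meas[measurable]: "l \<in> borel_measurable borel"
    by (rule borel_measurable_continuous_onI[OF l_cont])
  note H_meas[measurable]
  have "((\<lambda>T. LBINT x. indicator {-1..1} x *\<^sub>R l (u + b T * x) *\<^sub>R H T x)
      \<longlongrightarrow> (LBINT x. indicator {-1..1} x *\<^sub>R lam u *\<^sub>R H' x)) at_top"
  proof (rule integral_dominated_convergence_at_top[where w = "\<lambda>x. indicator {-1..1} x *\<^sub>R (A * B)"])
    show "integrable lborel (\<lambda>x. indicator {-1..1::real} x *\<^sub>R (A * B))"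
      by (intro integrable_scaleR_left integrable_real_indicator) auto
    show "\<forall>\<^sub>F T in at_top. AE x in lborel.
        norm (indicator {-1..1} x *\<^sub>R l (u + b T * x) *\<^sub>R H T x) \<le> indicator {-1..1} x *\<^sub>R (A * B)"
      using H_bound
    proof eventually_elim
      case (elim T)
      have "\<bar>l (u + b T * x)\<bar> * norm (H T x) \<le> A * B" if "x \<in> {-1..1}" for x
        using elim that l_bound[of "u + b T * x"] by (intro mult_mono) auto
      then show ?case by (auto simp: indicator_def)
    qed
    have "((\<lambda>T. l (u + b T * x)) \<longlongrightarrow> l u) at_top" for x
    proof -
      have "((\<lambda>T. u + b T * x) \<longlongrightarrow> u + 0 * x) at_top" by (intro tendsto_intros b)
      moreover have "isCont l (u + 0 * x)" using l_cont by (simp add: continuous_on_eq_continuous_at)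
      ultimately show ?thesis by (auto dest: isCont_tendsto_compose)
    qed
    moreover have "l u = lam u" using u by (intro l_eq) simp
    ultimately show "AE x in lborel. ((\<lambda>T. indicator {-1..1} x *\<^sub>R l (u + b T * x) *\<^sub>R H T x)
        \<longlongrightarrow> indicator {-1..1} x *\<^sub>R lam u *\<^sub>R H' x) at_top"
      using H_lim by (auto simp: indicator_def intro!: tendsto_scaleR)
  qed measurable
  moreover have "\<forall>\<^sub>F T in at_top. (LBINT x. indicator {-1..1} x *\<^sub>R l (u + b T * x) *\<^sub>R H T x)
      = (LBINT x:{-1..1}. lam (u + b T * x) *\<^sub>R H T x)"
  proof -
    have "0 < min u (1 - u)" using u by simp
    then have "\<forall>\<^sub>F T in at_top. \<bar>b T\<bar> < min u (1 - u)"
      using tendstoD[OF b, of "min u (1 - u)"] by (simp add: dist_real_def)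
    then show ?thesis
    proof eventually_elim
      case (elim T)
      have "u + b T * x \<in> {0..1}" if "x \<in> {-1..1}" for x
      proof -
        have "\<bar>b T * x\<bar> \<le> \<bar>b T\<bar> * 1" unfolding abs_mult using that by (intro mult_left_mono) auto
        then show ?thesis using elim by auto
      qed
      then show ?case unfolding set_lebesgue_integral_def
        by (intro Bochner_Integration.integral_cong refl) (auto simp: indicator_def l_eq)
    qed
  qed
  ultimately show ?thesis
    unfolding set_lebesgue_integral_def by (rule Lim_transform_eventually)
qed

section \<open>Bias\<close>

text \<open>At interior points the derivative within [0,1] is the ordinary two-sided one, which is
  what Taylor's theorem asks for.\<close>

lemma deriv01_has_real_derivative:
  assumes "deriv01 k f differentiable_on {0..1}" "0 < x" "x < 1"
  shows "(deriv01 k f has_real_derivative deriv01 (Suc k) f x) (at x)"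
proof -
  have "x \<in> interior {0..1}" using assms by simp
  then have at: "at x within {0..1} = at x" by (rule at_within_interior)
  have "deriv01 k f differentiable (at x within {0..1})"
    using assms by (auto simp: differentiable_on_def)
  then have "(deriv01 k f has_vector_derivative deriv01 (Suc k) f x) (at x within {0..1})"
    by (simp add: deriv01_def vector_derivative_works[symmetric])
  then show ?thesis by (simp add: at has_real_derivative_iff_has_vector_derivative)
qed

text \<open>In the Lagrange form the m-th derivative sits at an intermediate point
  \<open>u + h\<close>. Moving it to \<open>u\<close> costs a Hoelder increment of order \<gamma>,
  which joins the factor \<open>y ^ m\<close>.\<close>

lemma hoelder01_taylor_bound:
  assumes f: "hoelder01 m \<gamma> f" and \<gamma>: "0 < \<gamma>" and u: "0 < u" "u < 1"
  obtains C d where "0 \<le> C" "0 < d"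
    "\<And>y. \<bar>y\<bar> < d \<Longrightarrow> \<bar>f (u + y) - (\<Sum>k\<le>m. deriv01 k f u / fact k * y ^ k)\<bar> \<le> C * \<bar>y\<bar> powr (real m + \<gamma>)"
proof -
  from f obtain C \<delta> where "0 < \<delta>" and C: "\<And>x h. x \<in> {0..1} \<Longrightarrow> \<bar>h\<bar> < \<delta> \<Longrightarrow> x + h \<in> {0..1} \<Longrightarrow>
      \<bar>deriv01 m f (x + h) - deriv01 m f x\<bar> \<le> C * \<bar>h\<bar> powr \<gamma>"
    and diff: "\<And>k. k < m \<Longrightarrow> deriv01 k f differentiable_on {0..1}"
    unfolding hoelder01_def by blast
  \<comment> \<open>Small enough for the Hoelder condition and for \<open>u + y\<close> to stay
    inside (0,1).\<close>
  define d where "d = min \<delta> (min u (1 - u))"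
  have "0 < d" using \<open>0 < \<delta>\<close> u by (simp add: d_def)
  have bound: "\<bar>f (u + y) - (\<Sum>k\<le>m. deriv01 k f u / fact k * y ^ k)\<bar> \<le> \<bar>C\<bar> * \<bar>y\<bar> powr (real m + \<gamma>)"
    if y: "\<bar>y\<bar> < d" for y
  proof -
    have hoelder: "\<bar>deriv01 m f (u + h) - deriv01 m f u\<bar> \<le> \<bar>C\<bar> * \<bar>y\<bar> powr \<gamma>" if "\<bar>h\<bar> \<le> \<bar>y\<bar>" for h
    proof -
      have "\<bar>deriv01 m f (u + h) - deriv01 m f u\<bar> \<le> C * \<bar>h\<bar> powr \<gamma>"
        using that y u by (intro C) (auto simp: d_def)
      also have "\<dots> \<le> \<bar>C\<bar> * \<bar>y\<bar> powr \<gamma>"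
        using that \<gamma> by (intro mult_mono powr_mono2) auto
      finally show ?thesis .
    qed
    obtain h where h: "\<bar>h\<bar> \<le> \<bar>y\<bar>"
      "f (u + y) = (\<Sum>k<m. deriv01 k f u / fact k * y ^ k) + deriv01 m f (u + h) / fact m * y ^ m"
    \<comment> \<open>These are the cases outside the reach of Taylor's theorem with Lagrange
      remainder; there \<open>h = y\<close> works, since either the sum is empty or only its term
      \<open>k = 0\<close> survives.\<close>
    proof (cases "m = 0 \<or> y = 0")
      case True
      show ?thesis
      proof (rule that[of y])
        show "f (u + y) = (\<Sum>k<m. deriv01 k f u / fact k * y ^ k) + deriv01 m f (u + y) / fact m * y ^ m"
        proof (cases "m = 0")
          case False
          then have "(\<Sum>k<m. deriv01 k f u / fact k * 0 ^ k) = deriv01 0 f u"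
            by (subst sum.remove[of _ 0]) auto
          then show ?thesis using True False by (simp add: deriv01_def)
        qed (simp add: deriv01_def)
      qed simp
    next
      case False
      let ?a = "u - \<bar>y\<bar>" and ?b = "u + \<bar>y\<bar>"
      have "\<exists>t. (if u + y < u then u + y < t \<and> t < u else u < t \<and> t < u + y) \<and>
          f (u + y) = (\<Sum>k<m. deriv01 k f u / fact k * (u + y - u) ^ k) + deriv01 m f t / fact m * (u + y - u) ^ m"
      proof (rule Taylor)
        show "\<forall>k t. k < m \<and> ?a \<le> t \<and> t \<le> ?b \<longrightarrow> DERIV (deriv01 k f) t :> deriv01 (Suc k) f t"
          using y diff by (auto simp: d_def intro!: deriv01_has_real_derivative)
      qed (use False in \<open>auto simp: deriv01_def\<close>)
      then obtain t where "if u + y < u then u + y < t \<and> t < u else u < t \<and> t < u + y"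
        "f (u + y) = (\<Sum>k<m. deriv01 k f u / fact k * y ^ k) + deriv01 m f t / fact m * y ^ m"
        by auto
      then show ?thesis
        by (intro that[of "t - u"]) (auto split: if_splits)
    qed
    have "f (u + y) - (\<Sum>k\<le>m. deriv01 k f u / fact k * y ^ k)
        = (deriv01 m f (u + h) - deriv01 m f u) / fact m * y ^ m"
      unfolding h(2) lessThan_Suc_atMost[symmetric] sum.lessThan_Suc by (simp add: field_simps)
    also have "\<bar>\<dots>\<bar> \<le> (\<bar>C\<bar> * \<bar>y\<bar> powr \<gamma>) / 1 * \<bar>y\<bar> ^ m"
      unfolding abs_mult abs_divide power_abs
      by (intro mult_right_mono frac_le hoelder[OF h(1)]) (auto simp: fact_ge_1)
    also have "\<dots> = \<bar>C\<bar> * \<bar>y\<bar> powr (real m + \<gamma>)"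
      by (cases "y = 0") (use \<gamma> in \<open>auto simp: powr_add powr_realpow\<close>)
    finally show ?thesis .
  qed
  show ?thesis by (rule that[OF _ \<open>0 < d\<close> bound]) auto
qed

section \<open>Moments of the kernel and the size of the bias\<close>

lemma kernel_moment:
  fixes K :: "real \<Rightarrow> real"
  assumes "\<And>x. 1 \<le> \<bar>x\<bar> \<Longrightarrow> K x = 0"
  shows "(LBINT x:{-1..1}. f x * K x) = (LBINT x. f x * K x)"
  unfolding set_lebesgue_integral_def
proof (intro Bochner_Integration.integral_cong refl)
  fix x
  show "indicator {-1..1} x *\<^sub>R (f x * K x) = f x * K x"
    using assms[of x] by (cases "x \<in> {-1..1}") auto
qed

lemma kernel_first_moment:
  fixes K :: "real \<Rightarrow> real"
  assumes "\<And>x. K (- x) = K x"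
  shows "(LBINT x. x * K x) = 0"
proof -
  have "(LBINT x. x * K x) = (LBINT x. - (x * K x))"
    using lborel_integral_real_affine[of "-1" "\<lambda>x. x * K x" 0] assms by simp
  then show ?thesis by simp
qed

text \<open>The centre and the bias term together are exactly the kernel integral of the Taylor
  polynomial of \<open>lam\<close>, so only the Taylor remainder is left to integrate.\<close>

lemma kernel_bias_bound:
  assumes lam: "hoelder01 m \<gamma> lam" and m: "m \<in> {0, 1, 2}" and \<gamma>: "0 < \<gamma>" and u: "0 < u" "u < 1"
    and lam_cont: "continuous_on {0..1} lam"
    and K: "continuous_on UNIV K" "\<And>x. 0 \<le> K x" "\<And>x. K (- x) = K x"
      "\<And>x. 1 \<le> \<bar>x\<bar> \<Longrightarrow> K x = 0" "(LBINT x. K x) = 1"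
  obtains C d where "0 \<le> C" "0 < d"
    "\<And>b. 0 < b \<Longrightarrow> b < d \<Longrightarrow> \<bar>(LBINT x:{-1..1}. lam (u + b * x) *\<^sub>R K x) - lam u
      - b\<^sup>2 / 2 * deriv01 2 lam u * (LBINT x. x\<^sup>2 * K x) * of_bool (m = 2)\<bar> \<le> C * b powr (real m + \<gamma>)"
proof -
  obtain C d where "0 \<le> C" "0 < d" and C: "\<And>y. \<bar>y\<bar> < d \<Longrightarrow>
      \<bar>lam (u + y) - (\<Sum>k\<le>m. deriv01 k lam u / fact k * y ^ k)\<bar> \<le> C * \<bar>y\<bar> powr (real m + \<gamma>)"
    using hoelder01_taylor_bound[OF lam \<gamma> u] by blast
  define d' where "d' = min d (min u (1 - u))"
  have "0 < d'" using \<open>0 < d\<close> u by (simp add: d'_def)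
  have K1: "(LBINT x:{-1..1}. K x) = 1"
    using kernel_moment[of K "\<lambda>_. 1"] K by simp
  have bound: "\<bar>(LBINT x:{-1..1}. lam (u + b * x) *\<^sub>R K x) - lam u
      - b\<^sup>2 / 2 * deriv01 2 lam u * (LBINT x. x\<^sup>2 * K x) * of_bool (m = 2)\<bar> \<le> C * b powr (real m + \<gamma>)"
    if b: "0 < b" "b < d'" for b
  proof -
    define P where "P y = (\<Sum>k\<le>m. deriv01 k lam u / fact k * y ^ k)" for y
    have bx: "\<bar>b * x\<bar> \<le> b" if "x \<in> {-1..1}" for x
    proof -
      have "b * \<bar>x\<bar> \<le> b * 1" using that b by (intro mult_left_mono) auto
      then show ?thesis using b by (simp add: abs_mult)
    qed
    have "u + b * x \<in> {0..1}" if "x \<in> {-1..1}" for x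
      using bx[OF that] b by (auto simp: d'_def)
    then have "continuous_on {-1..1} (\<lambda>x. lam (u + b * x) *\<^sub>R K x)"
      by (intro continuous_intros continuous_on_compose2[OF lam_cont] continuous_on_subset[OF K(1)]) auto
    then have int_lam: "set_integrable lborel {-1..1} (\<lambda>x. lam (u + b * x) *\<^sub>R K x)"
      by (rule borel_integrable_atLeastAtMost')
    have "continuous_on {-1..1} (\<lambda>x. x ^ k * K x)" for k
      by (intro continuous_intros continuous_on_subset[OF K(1)]) auto
    then have int_pow: "set_integrable lborel {-1..1} (\<lambda>x. x ^ k * K x)" for k
      by (rule borel_integrable_atLeastAtMost')
    have P_K: "P (b * x) * K x = (\<Sum>k\<le>m. (deriv01 k lam u / fact k * b ^ k) * (x ^ k * K x))" for x
      unfolding P_def sum_distrib_right by (simp add: power_mult_distrib mult_ac)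
    have int_term: "integrable lborel (\<lambda>x. indicator {-1..1} x *\<^sub>R ((deriv01 k lam u / fact k * b ^ k) * (x ^ k * K x)))" for k
      using set_integrable_mult_right[OF int_pow] unfolding set_integrable_def by blast
    have int_P: "set_integrable lborel {-1..1} (\<lambda>x. P (b * x) * K x)"
      unfolding P_K set_integrable_def scaleR_sum_right
      by (intro Bochner_Integration.integrable_sum int_term)
    have "(LBINT x:{-1..1}. P (b * x) * K x)
        = (\<Sum>k\<le>m. LBINT x:{-1..1}. (deriv01 k lam u / fact k * b ^ k) * (x ^ k * K x))"
      unfolding P_K set_lebesgue_integral_def scaleR_sum_right
      by (intro Bochner_Integration.integral_sum int_term)
    also have "\<dots> = (\<Sum>k\<le>m. (deriv01 k lam u / fact k * b ^ k) * (LBINT x:{-1..1}. x ^ k * K x))"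
      by simp
    also have "\<dots> = (\<Sum>k\<le>m. (deriv01 k lam u / fact k * b ^ k) * (LBINT x. x ^ k * K x))"
      by (simp add: kernel_moment[OF K(4)])
    \<comment> \<open>Moment 0 is 1 and moment 1 is 0; a second-order term occurs only when the
      polynomial has degree 2, which is the origin of the indicator.\<close>
    also have "\<dots> = lam u + b\<^sup>2 / 2 * deriv01 2 lam u * (LBINT x. x\<^sup>2 * K x) * of_bool (m = 2)"
      using m K(5) kernel_first_moment[of K, OF K(3)]
      by (auto simp: numeral_2_eq_2 deriv01_def)
    finally have "(LBINT x:{-1..1}. lam (u + b * x) *\<^sub>R K x) - lam u
      - b\<^sup>2 / 2 * deriv01 2 lam u * (LBINT x. x\<^sup>2 * K x) * of_bool (m = 2)
      = (LBINT x:{-1..1}. lam (u + b * x) *\<^sub>R K x) - (LBINT x:{-1..1}. P (b * x) * K x)"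
      by simp
    also have "\<dots> = (LBINT x:{-1..1}. lam (u + b * x) *\<^sub>R K x - P (b * x) * K x)"
      by (rule set_integral_diff(2)[OF int_lam int_P, symmetric])
    also have "\<bar>\<dots>\<bar> \<le> (LBINT x:{-1..1}. \<bar>lam (u + b * x) *\<^sub>R K x - P (b * x) * K x\<bar>)"
      using set_integral_norm_bound[OF set_integral_diff(1)[OF int_lam int_P]] by simp
    also have "\<dots> \<le> (LBINT x:{-1..1}. (C * b powr (real m + \<gamma>)) * K x)"
    proof (rule set_integral_mono)
      show "set_integrable lborel {-1..1} (\<lambda>x. \<bar>lam (u + b * x) *\<^sub>R K x - P (b * x) * K x\<bar>)"
        by (intro set_integrable_abs set_integral_diff int_lam int_P)
      show "set_integrable lborel {-1..1} (\<lambda>x. (C * b powr (real m + \<gamma>)) * K x)"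
        using set_integrable_mult_right[OF int_pow[of 0]] by simp
      fix x :: real assume x: "x \<in> {-1..1}"
      have "\<bar>lam (u + b * x) - P (b * x)\<bar> \<le> C * \<bar>b * x\<bar> powr (real m + \<gamma>)"
        unfolding P_def using bx[OF x] b by (intro C) (auto simp: d'_def)
      \<comment> \<open>On the window \<open>\<bar>b * x\<bar>\<close> is at most \<open>b\<close>,
        so the bound is uniform in \<open>x\<close>; as \<open>K\<close> is nonnegative with
        integral 1, integrating preserves the constant.\<close>
      also have "\<dots> \<le> C * b powr (real m + \<gamma>)"
        using bx[OF x] \<open>0 \<le> C\<close> \<gamma> by (intro mult_left_mono powr_mono2) auto
      finally have "\<bar>lam (u + b * x) - P (b * x)\<bar> * K x \<le> C * b powr (real m + \<gamma>) * K x"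
        by (intro mult_right_mono K(2))
      then show "\<bar>lam (u + b * x) *\<^sub>R K x - P (b * x) * K x\<bar> \<le> C * b powr (real m + \<gamma>) * K x"
        using K(2)[of x] by (simp add: abs_mult flip: left_diff_distrib)
    qed
    also have "\<dots> = C * b powr (real m + \<gamma>)" by (simp add: K1)
    finally show ?thesis .
  qed
  show ?thesis by (rule that[OF \<open>0 \<le> C\<close> \<open>0 < d'\<close> bound])
qed

section \<open>Consistency and asymptotic normality\<close>

text \<open>The first bound dominates the integrand for consistency. The second gives its limit and
  also dominates the integrand of the central limit theorem, whose limit comes from the
  third.\<close>

lemma iexp_taylor_bounds:
  fixes y :: real
  shows "cmod (iexp y - 1) \<le> \<bar>y\<bar>"
    and "cmod (iexp y - 1 - \<i> * y) \<le> y\<^sup>2 / 2"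
    and "cmod (iexp y - 1 - \<i> * y + y\<^sup>2 / 2) \<le> \<bar>y\<bar> ^ 3 / 6"
proof -
  show "cmod (iexp y - 1) \<le> \<bar>y\<bar>"
    using iexp_approx1[of y 0] by simp
  show "cmod (iexp y - 1 - \<i> * y) \<le> y\<^sup>2 / 2"
    using iexp_approx1[of y 1] by (simp add: diff_diff_eq numeral_2_eq_2)
  have "iexp y - (\<Sum>k\<le>2. (\<i> * y) ^ k / fact k) = iexp y - 1 - \<i> * y + y\<^sup>2 / 2"
    by (simp add: numeral_2_eq_2 field_simps)
  moreover have "cmod (iexp y - (\<Sum>k\<le>2. (\<i> * y) ^ k / fact k)) \<le> \<bar>y\<bar> ^ 3 / 6"
    using iexp_approx1[of y 2] by (simp add: fact_numeral)
  ultimately show "cmod (iexp y - 1 - \<i> * y + y\<^sup>2 / 2) \<le> \<bar>y\<bar> ^ 3 / 6"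
    by metis
qed

lemma tendsto_iexp_linear:
  assumes s: "filterlim s at_top F"
  shows "((\<lambda>T. s T *\<^sub>R (iexp (y / s T) - 1)) \<longlongrightarrow> \<i> * of_real y) F"
proof -
  have "((\<lambda>T. s T *\<^sub>R (iexp (y / s T) - 1) - \<i> * of_real y) \<longlongrightarrow> 0) F"
  proof (rule tendsto_norm_zero_cancel, rule tendsto_sandwich[OF _ _ tendsto_const])
    show "((\<lambda>T. (y\<^sup>2 / 2) / s T) \<longlongrightarrow> 0) F"
      by (rule real_tendsto_divide_at_top[OF tendsto_const s])
    show "\<forall>\<^sub>F T in F. norm (s T *\<^sub>R (iexp (y / s T) - 1) - \<i> * of_real y) \<le> (y\<^sup>2 / 2) / s T"
      using filterlim_at_top_dense[THEN iffD1, OF s, rule_format, of 0]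
    proof eventually_elim
      case (elim T)
      have "s T *\<^sub>R (iexp (y / s T) - 1) - \<i> * of_real y
          = s T *\<^sub>R (iexp (y / s T) - 1 - \<i> * of_real (y / s T))"
        using elim by (simp add: scaleR_conv_of_real algebra_simps)
      then have "norm (s T *\<^sub>R (iexp (y / s T) - 1) - \<i> * of_real y)
          = s T * cmod (iexp (y / s T) - 1 - \<i> * of_real (y / s T))"
        using elim by simp
      also have "\<dots> \<le> s T * ((y / s T)\<^sup>2 / 2)"
        using elim by (intro mult_left_mono iexp_taylor_bounds) simp
      finally show ?case using elim by (simp add: power2_eq_square)
    qed
  qed simp
  then show ?thesis by (rule LIM_zero_cancel)
qed

text \<open>With the linear term removed, scaling by the square of \<open>q\<close> isolates the
  second-order coefficient; the remainder is at most \<open>\<bar>y\<bar> ^ 3 / 6\<close> divided by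
  \<open>q T\<close>.\<close>

lemma tendsto_iexp_quadratic:
  assumes q: "filterlim q at_top F"
  shows "((\<lambda>T. (q T)\<^sup>2 *\<^sub>R (iexp (y / q T) - 1 - \<i> * of_real (y / q T))) \<longlongrightarrow> - (of_real (y\<^sup>2) / 2)) F"
proof -
  have "((\<lambda>T. (q T)\<^sup>2 *\<^sub>R (iexp (y / q T) - 1 - \<i> * of_real (y / q T)) - (- (of_real (y\<^sup>2) / 2))) \<longlongrightarrow> 0) F"
  proof (rule tendsto_norm_zero_cancel, rule tendsto_sandwich[OF _ _ tendsto_const])
    show "((\<lambda>T. (\<bar>y\<bar> ^ 3 / 6) / q T) \<longlongrightarrow> 0) F"
      by (rule real_tendsto_divide_at_top[OF tendsto_const q])
    show "\<forall>\<^sub>F T in F. norm ((q T)\<^sup>2 *\<^sub>R (iexp (y / q T) - 1 - \<i> * of_real (y / q T)) - (- (of_real (y\<^sup>2) / 2)))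
        \<le> (\<bar>y\<bar> ^ 3 / 6) / q T"
      using filterlim_at_top_dense[THEN iffD1, OF q, rule_format, of 0]
    proof eventually_elim
      case (elim T)
      have "(q T)\<^sup>2 *\<^sub>R (iexp (y / q T) - 1 - \<i> * of_real (y / q T)) - (- (of_real (y\<^sup>2) / 2))
          = (q T)\<^sup>2 *\<^sub>R (iexp (y / q T) - 1 - \<i> * of_real (y / q T) + (of_real (y / q T))\<^sup>2 / 2)"
        using elim by (simp add: scaleR_conv_of_real algebra_simps power_divide)
      then have "norm ((q T)\<^sup>2 *\<^sub>R (iexp (y / q T) - 1 - \<i> * of_real (y / q T)) - (- (of_real (y\<^sup>2) / 2)))
          = (q T)\<^sup>2 * cmod (iexp (y / q T) - 1 - \<i> * of_real (y / q T) + (of_real (y / q T))\<^sup>2 / 2)"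
        by (simp only: norm_scaleR abs_power2)
      also have "\<dots> \<le> (q T)\<^sup>2 * (\<bar>y / q T\<bar> ^ 3 / 6)"
        using iexp_taylor_bounds(3)[of "y / q T"] by (intro mult_left_mono) auto
      finally show ?case using elim by (simp add: power2_eq_square power3_eq_cube)
    qed
  qed simp
  then show ?thesis by (rule LIM_zero_cancel)
qed

text \<open>Positivity of the bandwidth comes from the divergence of \<open>b T * T\<close>, as
  \<open>T\<close> itself is eventually positive. The free bound \<open>d\<close> later makes room
  for the Taylor expansion.\<close>

lemma eventually_bandwidth:
  assumes u: "0 < u" "u < (1::real)"
    and b: "(b \<longlongrightarrow> 0) at_top" and bT: "filterlim (\<lambda>T. b T * T) at_top at_top"
    and "0 < d"
  shows "\<forall>\<^sub>F T in at_top. 0 < T \<and> 0 < b T \<and> b T \<le> u \<and> b T \<le> 1 - u \<and> b T < d"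
proof -
  have "\<forall>\<^sub>F T in at_top. \<bar>b T\<bar> < min d (min u (1 - u))"
    using tendstoD[OF b, of "min d (min u (1 - u))"] u \<open>0 < d\<close> by (simp add: dist_real_def)
  moreover have "\<forall>\<^sub>F T in at_top. 0 < b T * T"
    using filterlim_at_top_dense[THEN iffD1, OF bT] by blast
  ultimately show ?thesis using eventually_gt_at_top[of 0]
    by eventually_elim (auto simp: zero_less_mult_iff)
qed

text \<open>The shift \<open>c\<close> only multiplies the characteristic function by a phase
  tending to 1. It allows one statement to cover both the centring at the mean and the centring at
  \<open>lam u\<close> plus bias.\<close>

lemma (in prob_space)
  fixes N :: "real \<Rightarrow> real \<Rightarrow> 'a \<Rightarrow> nat"
  assumes pp: "\<And>T. 0 < T \<Longrightarrow> poisson_process M T (\<lambda>t. lam (t / T)) (N T)"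
    and lam: "continuous_on {0..1} lam" "\<And>x. x \<in> {0..1} \<Longrightarrow> 0 \<le> lam x"
    and u: "0 < u" "u < 1"
    and b: "(b \<longlongrightarrow> 0) at_top" and bT: "filterlim (\<lambda>T. b T * T) at_top at_top"
    and K: "continuous_on UNIV K" "\<And>x. 1 \<le> \<bar>x\<bar> \<Longrightarrow> K x = 0"
  shows intensity_estimator_consistent:
      "(LBINT x. K x) = 1 \<Longrightarrow>
        converges_in_probability M (\<lambda>T. intensity_estimator K (b T) T (N T) u) (lam u) at_top"
    and intensity_estimator_clt:
      "0 < lam u * (LBINT x. (K x)\<^sup>2) \<Longrightarrow> (c \<longlongrightarrow> 0) at_top \<Longrightarrow>
        converges_in_distribution M
          (\<lambda>T \<omega>. sqrt (b T * T) * (intensity_estimator K (b T) T (N T) u \<omega>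
              - expectation (intensity_estimator K (b T) T (N T) u)) + c T)
          (normal_law 0 (lam u * (LBINT x. (K x)\<^sup>2))) at_top"
proof -
  let ?est = "\<lambda>T. intensity_estimator K (b T) T (N T) u"
  note ev = eventually_bandwidth[OF u b bT zero_less_one]
  have est: "?est T \<in> borel_measurable M"
      "expectation (?est T) = (LBINT x:{-1..1}. lam (u + b T * x) *\<^sub>R K x)"
      "expectation (\<lambda>\<omega>. iexp (\<theta> * ?est T \<omega>))
        = exp ((b T * T) *\<^sub>R (LBINT x:{-1..1}. lam (u + b T * x) *\<^sub>R (iexp (\<theta> * K x / (b T * T)) - 1)))"
    if T: "0 < T \<and> 0 < b T \<and> b T \<le> u \<and> b T \<le> 1 - u \<and> b T < 1" for T \<theta>
  proof -
    have T': "0 < T" "0 < b T" "b T \<le> u" "b T \<le> 1 - u" using T by auto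
    note moments = intensity_estimator_moments[OF T'(1) pp[OF T'(1)] T'(2-4) lam K]
    show "?est T \<in> borel_measurable M"
      "expectation (?est T) = (LBINT x:{-1..1}. lam (u + b T * x) *\<^sub>R K x)"
      "expectation (\<lambda>\<omega>. iexp (\<theta> * ?est T \<omega>))
        = exp ((b T * T) *\<^sub>R (LBINT x:{-1..1}. lam (u + b T * x) *\<^sub>R (iexp (\<theta> * K x / (b T * T)) - 1)))"
      by ((rule moments; simp)+)
  qed
  have meas: "\<forall>\<^sub>F T in at_top. ?est T \<in> borel_measurable M"
    using ev by eventually_elim (rule est)
  have K_meas[measurable]: "K \<in> borel_measurable borel"
    by (rule borel_measurable_continuous_onI[OF K(1)])
  have "bounded (K ` {-1..1})"
    by (intro compact_imp_bounded compact_continuous_image continuous_on_subset[OF K(1)]) auto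
  then obtain B where B: "\<forall>x\<in>{-1..1}. \<bar>K x\<bar> \<le> B"
    unfolding bounded_iff by (auto simp only: ball_simps real_norm_def)
  have pos: "\<forall>\<^sub>F T in at_top. 0 < b T * T"
    using ev by eventually_elim simp

  show "converges_in_probability M ?est (lam u) at_top" if K1: "(LBINT x. K x) = 1"
  proof (rule converges_in_probability_if_char[OF meas])
    fix \<theta>
    \<comment> \<open>\<open>H\<close> absorbs the diverging prefactor \<open>b T * T\<close>. The
      first-order bound for \<open>iexp\<close> cancels it again, which leaves the uniform bound
      \<open>\<bar>\<theta>\<bar> * B\<close>.\<close>
    define H where "H T x = (b T * T) *\<^sub>R (iexp (\<theta> * K x / (b T * T)) - 1)" for T x
    have "((\<lambda>T. LBINT x:{-1..1}. lam (u + b T * x) *\<^sub>R H T x)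
        \<longlongrightarrow> (LBINT x:{-1..1}. lam u *\<^sub>R (\<i> * of_real (\<theta> * K x)))) at_top"
    proof (rule tendsto_kernel_integral[OF lam(1) u b, where B = "\<bar>\<theta>\<bar> * B"])
      show "H T \<in> borel_measurable borel" for T unfolding H_def by measurable
      show "\<forall>\<^sub>F T in at_top. \<forall>x\<in>{-1..1}. norm (H T x) \<le> \<bar>\<theta>\<bar> * B"
        using pos
      proof eventually_elim
        case (elim T)
        show ?case
        proof
          fix x :: real assume x: "x \<in> {-1..1}"
          have "norm (H T x) = (b T * T) * cmod (iexp (\<theta> * K x / (b T * T)) - 1)"
            unfolding H_def norm_scaleR using elim by (simp only: abs_of_pos)
          also have "\<dots> \<le> (b T * T) * \<bar>\<theta> * K x / (b T * T)\<bar>"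
            using elim by (intro mult_left_mono iexp_taylor_bounds) simp
          also have "\<dots> = \<bar>\<theta>\<bar> * \<bar>K x\<bar>"
            by (simp only: abs_divide abs_of_pos[OF elim] abs_mult[of \<theta>] times_divide_eq_right
                nonzero_mult_div_cancel_left[OF less_imp_neq[OF elim, symmetric]])
          also have "\<dots> \<le> \<bar>\<theta>\<bar> * B" using B x by (intro mult_left_mono) auto
          finally show "norm (H T x) \<le> \<bar>\<theta>\<bar> * B" .
        qed
      qed
      show "((\<lambda>T. H T x) \<longlongrightarrow> \<i> * of_real (\<theta> * K x)) at_top" for x
        unfolding H_def by (rule tendsto_iexp_linear[OF bT])
    qed measurable
    also have "(LBINT x:{-1..1}. lam u *\<^sub>R (\<i> * of_real (\<theta> * K x)))
        = \<i> * of_real (\<theta> * lam u * (LBINT x:{-1..1}. 1 * K x))"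
    proof -
      have "(LBINT x:{-1..1}. lam u *\<^sub>R (\<i> * of_real (\<theta> * K x)))
          = (LBINT x:{-1..1}. (\<i> * of_real (\<theta> * lam u)) * complex_of_real (1 * K x))"
        by (intro set_lebesgue_integral_cong) (auto simp: scaleR_conv_of_real mult_ac)
      also have "\<dots> = (\<i> * of_real (\<theta> * lam u)) * complex_of_real (LBINT x:{-1..1}. 1 * K x)"
        by (simp only: set_integral_mult_right set_integral_complex_of_real)
      finally show ?thesis by (simp add: mult_ac)
    qed
    also have "\<dots> = \<i> * of_real (\<theta> * lam u)"
    proof -
      have "(LBINT x:{-1..1}. 1 * K x) = (LBINT x. 1 * K x)"
        by (rule kernel_moment) (rule K(2))
      then show ?thesis by (simp add: K1)
    qed
    finally have "((\<lambda>T. exp (LBINT x:{-1..1}. lam (u + b T * x) *\<^sub>R H T x)) \<longlongrightarrow> iexp (\<theta> * lam u)) at_top"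
      by (rule tendsto_exp)
    moreover have "\<forall>\<^sub>F T in at_top. exp (LBINT x:{-1..1}. lam (u + b T * x) *\<^sub>R H T x)
        = expectation (\<lambda>\<omega>. iexp (\<theta> * ?est T \<omega>))"
      using ev
    proof eventually_elim
      case (elim T)
      show ?case
        unfolding est(3)[OF elim] H_def set_lebesgue_integral_def integral_scaleR_right[symmetric]
        by (simp only: scaleR_left_commute)
    qed
    ultimately show "((\<lambda>T. expectation (\<lambda>\<omega>. iexp (\<theta> * ?est T \<omega>))) \<longlongrightarrow> iexp (\<theta> * lam u)) at_top"
      by (rule Lim_transform_eventually)
  qed

  define v where "v = lam u * (LBINT x. (K x)\<^sup>2)"
  define q where "q T = sqrt (b T * T)" for T
  have q: "filterlim q at_top at_top"
    unfolding q_def by (rule filterlim_compose[OF sqrt_at_top bT])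
  show "converges_in_distribution M (\<lambda>T \<omega>. sqrt (b T * T) * (?est T \<omega> - expectation (?est T)) + c T)
          (normal_law 0 (lam u * (LBINT x. (K x)\<^sup>2))) at_top"
    if "0 < lam u * (LBINT x. (K x)\<^sup>2)" and c: "(c \<longlongrightarrow> 0) at_top"
    unfolding v_def[symmetric] q_def[symmetric]
  proof (rule converges_in_distribution_if_char)
    have "0 < v" using that by (simp add: v_def)
    then show "real_distribution (normal_law 0 v)" by (rule real_distribution_normal_law)
    show "\<forall>\<^sub>F T in at_top. (\<lambda>\<omega>. q T * (?est T \<omega> - expectation (?est T)) + c T) \<in> borel_measurable M"
      using meas
      by eventually_elim
        (intro borel_measurable_add borel_measurable_times borel_measurable_diff borel_measurable_const)
    fix \<theta>
    \<comment> \<open>The integrand of the centred exponent: the subtracted linear part is the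
      contribution of the mean, as \<open>H_eq\<close> and \<open>lin\<close> verify below.\<close>
    define H where "H T x = (q T)\<^sup>2 *\<^sub>R (iexp (\<theta> * K x / q T) - 1 - \<i> * of_real (\<theta> * K x / q T))" for T x
    have "((\<lambda>T. LBINT x:{-1..1}. lam (u + b T * x) *\<^sub>R H T x)
        \<longlongrightarrow> (LBINT x:{-1..1}. lam u *\<^sub>R (- (of_real ((\<theta> * K x)\<^sup>2) / 2)))) at_top"
    proof (rule tendsto_kernel_integral[OF lam(1) u b, where B = "(\<bar>\<theta>\<bar> * B)\<^sup>2 / 2"])
      show "H T \<in> borel_measurable borel" for T unfolding H_def by measurable
      show "\<forall>\<^sub>F T in at_top. \<forall>x\<in>{-1..1}. norm (H T x) \<le> (\<bar>\<theta>\<bar> * B)\<^sup>2 / 2"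
        using pos
      proof eventually_elim
        case (elim T)
        then have "q T > 0" by (simp add: q_def)
        show ?case
        proof
          fix x :: real assume x: "x \<in> {-1..1}"
          have "norm (H T x) = (q T)\<^sup>2 * cmod (iexp (\<theta> * K x / q T) - 1 - \<i> * of_real (\<theta> * K x / q T))"
            unfolding H_def norm_scaleR by (simp only: abs_power2)
          also have "\<dots> \<le> (q T)\<^sup>2 * ((\<theta> * K x / q T)\<^sup>2 / 2)"
            by (intro mult_left_mono iexp_taylor_bounds) simp
          also have "\<dots> = (\<bar>\<theta>\<bar> * \<bar>K x\<bar>)\<^sup>2 / 2"
            using \<open>q T > 0\<close> by (simp add: power_divide power_mult_distrib)
          also have "\<dots> \<le> (\<bar>\<theta>\<bar> * B)\<^sup>2 / 2"
            using B x by (intro divide_right_mono power_mono mult_left_mono) auto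
          finally show "norm (H T x) \<le> (\<bar>\<theta>\<bar> * B)\<^sup>2 / 2" .
        qed
      qed
      show "((\<lambda>T. H T x) \<longlongrightarrow> - (of_real ((\<theta> * K x)\<^sup>2) / 2)) at_top" for x
        unfolding H_def by (rule tendsto_iexp_quadratic[OF q])
    qed measurable
    also have "(LBINT x:{-1..1}. lam u *\<^sub>R (- (complex_of_real ((\<theta> * K x)\<^sup>2) / 2))) = - of_real (v * \<theta>\<^sup>2 / 2)"
    proof -
      have "(LBINT x:{-1..1}. lam u *\<^sub>R (- (complex_of_real ((\<theta> * K x)\<^sup>2) / 2)))
          = (LBINT x:{-1..1}. (- of_real (\<theta>\<^sup>2 * lam u / 2)) * complex_of_real (K x * K x))"
        by (intro set_lebesgue_integral_cong) (auto simp: scaleR_conv_of_real mult_ac power2_eq_square)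
      also have "\<dots> = (- of_real (\<theta>\<^sup>2 * lam u / 2)) * complex_of_real (LBINT x:{-1..1}. K x * K x)"
        by (simp only: set_integral_mult_right set_integral_complex_of_real)
      also have "(LBINT x:{-1..1}. K x * K x) = (LBINT x. (K x)\<^sup>2)"
        by (simp only: kernel_moment[OF K(2)] power2_eq_square)
      finally show ?thesis by (simp add: v_def mult_ac)
    qed
    finally have "((\<lambda>T. exp (\<i> * of_real (\<theta> * c T) + (LBINT x:{-1..1}. lam (u + b T * x) *\<^sub>R H T x)))
        \<longlongrightarrow> exp (\<i> * of_real (\<theta> * 0) + (- of_real (v * \<theta>\<^sup>2 / 2)))) at_top"
      by (intro tendsto_intros c)
    then have "((\<lambda>T. exp (\<i> * of_real (\<theta> * c T) + (LBINT x:{-1..1}. lam (u + b T * x) *\<^sub>R H T x)))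
        \<longlongrightarrow> char (normal_law 0 v) \<theta>) at_top"
      by (simp add: char_normal_law[OF \<open>0 < v\<close>])
    moreover have "\<forall>\<^sub>F T in at_top. exp (\<i> * of_real (\<theta> * c T) + (LBINT x:{-1..1}. lam (u + b T * x) *\<^sub>R H T x))
        = expectation (\<lambda>\<omega>. iexp (\<theta> * (q T * (?est T \<omega> - expectation (?est T)) + c T)))"
      using ev
    proof eventually_elim
      case (elim T)
      then have q_pos: "q T > 0" and q2: "b T * T = (q T)\<^sup>2" by (auto simp: q_def)
      define \<mu> where "\<mu> = expectation (?est T)"
      define E where "E x = lam (u + b T * x) *\<^sub>R (iexp (\<theta> * K x / q T) - 1)" for x
      define D where "D x = complex_of_real (lam (u + b T * x) *\<^sub>R K x)" for x
      have range: "u + b T * x \<in> {0..1}" if "x \<in> {-1..1}" for x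
      proof -
        have "\<bar>b T * x\<bar> \<le> b T * 1" unfolding abs_mult using that elim by (intro mult_mono) auto
        then show ?thesis using elim by auto
      qed
      have lam_cont: "continuous_on {-1..1} (\<lambda>x. lam (u + b T * x))"
        by (intro continuous_on_compose2[OF lam(1)] continuous_intros) (use range in auto)
      have K_cont: "continuous_on {-1..1} K" using K(1) by (rule continuous_on_subset) simp
      have "continuous_on {-1..1} E" "continuous_on {-1..1} D"
        unfolding E_def D_def using q_pos by (intro continuous_intros lam_cont K_cont; simp)+
      then have int: "set_integrable lborel {-1..1} E" "set_integrable lborel {-1..1} D"
        by (auto intro: borel_integrable_atLeastAtMost')
      \<comment> \<open>Splits off the mean: \<open>E\<close> belongs to the uncentred
        characteristic function and \<open>D\<close> integrates to the expectation \<mu>. The factor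
        \<open>\<theta> * q T\<close> arises as \<open>(q T)\<^sup>2\<close> times
        \<open>\<theta> / q T\<close>.\<close>
      have H_eq: "lam (u + b T * x) *\<^sub>R H T x = (q T)\<^sup>2 *\<^sub>R E x - (\<i> * of_real (\<theta> * q T)) * D x" for x
        using q_pos by (simp add: H_def E_def D_def scaleR_conv_of_real field_simps power2_eq_square)
      have "(LBINT x:{-1..1}. lam (u + b T * x) *\<^sub>R H T x)
          = (q T)\<^sup>2 *\<^sub>R (LBINT x:{-1..1}. E x) - (\<i> * of_real (\<theta> * q T)) * (LBINT x:{-1..1}. D x)"
        unfolding H_eq using int
        by (subst set_integral_diff(2)) (auto simp: scaleR_conv_of_real intro!: set_integrable_mult_right)
      also have "(LBINT x:{-1..1}. D x) = of_real \<mu>"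
        unfolding D_def \<mu>_def est(2)[OF elim] by (rule set_integral_complex_of_real)
      finally have lin: "(LBINT x:{-1..1}. lam (u + b T * x) *\<^sub>R H T x)
          = (q T)\<^sup>2 *\<^sub>R (LBINT x:{-1..1}. E x) - (\<i> * of_real (\<theta> * q T)) * of_real \<mu>" .
      \<comment> \<open>Multiplying the estimator by \<open>q T\<close> evaluates its characteristic
        function at the frequency \<open>\<theta> * q T\<close>, and \<open>q T / (b T * T)\<close>
        is \<open>1 / q T\<close>.\<close>
      have "(\<theta> * q T) * K x / (b T * T) = \<theta> * K x / q T" for x
        using q_pos by (simp add: q2 power2_eq_square)
      then have char: "expectation (\<lambda>\<omega>. iexp ((\<theta> * q T) * ?est T \<omega>)) = exp ((q T)\<^sup>2 *\<^sub>R (LBINT x:{-1..1}. E x))"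
        unfolding est(3)[OF elim] E_def by (simp only: q2)
      have "iexp (\<theta> * (q T * (?est T \<omega> - \<mu>) + c T))
          = exp (\<i> * of_real (\<theta> * c T) - (\<i> * of_real (\<theta> * q T)) * of_real \<mu>) * iexp ((\<theta> * q T) * ?est T \<omega>)" for \<omega>
        by (simp add: exp_add[symmetric] algebra_simps)
      then have "expectation (\<lambda>\<omega>. iexp (\<theta> * (q T * (?est T \<omega> - \<mu>) + c T)))
          = exp (\<i> * of_real (\<theta> * c T) - (\<i> * of_real (\<theta> * q T)) * of_real \<mu>) * exp ((q T)\<^sup>2 *\<^sub>R (LBINT x:{-1..1}. E x))"
        by (simp only: integral_mult_right_zero char)
      also have "\<dots> = exp (\<i> * of_real (\<theta> * c T) + (LBINT x:{-1..1}. lam (u + b T * x) *\<^sub>R H T x))"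
        unfolding lin exp_add[symmetric] by (simp add: algebra_simps)
      finally show ?case by (simp only: \<mu>_def)
    qed
    ultimately show "((\<lambda>T. expectation (\<lambda>\<omega>. iexp (\<theta> * (q T * (?est T \<omega> - expectation (?est T)) + c T))))
        \<longlongrightarrow> char (normal_law 0 v) \<theta>) at_top"
      by (rule Lim_transform_eventually)
  qed
qed

text \<open>Makes the limit variance strictly positive. From \<open>(K x - 1/2)^2 \<ge> 0\<close>,
  integrated over an interval of length 2, the integral of the square is at least 1/2, with equality
  for the uniform kernel that Cauchy-Schwarz suggests.\<close>

lemma kernel_square_integral_pos:
  fixes K :: "real \<Rightarrow> real"
  assumes K: "continuous_on UNIV K" "\<And>x. 1 \<le> \<bar>x\<bar> \<Longrightarrow> K x = 0" and K1: "(LBINT x. K x) = 1"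
  shows "0 < (LBINT x. (K x)\<^sup>2)"
proof -
  have cont: "continuous_on {-1..1} K" using K(1) by (rule continuous_on_subset) simp
  have int: "set_integrable lborel {-1..1} K" "set_integrable lborel {-1..1} (\<lambda>x. K x * K x)"
    "set_integrable lborel {-1..1::real} (\<lambda>x. 1 / 4 :: real)"
    using cont by (auto intro!: borel_integrable_atLeastAtMost' continuous_intros)
  have "1 = (LBINT x:{-1..1}. K x)" using kernel_moment[of K "\<lambda>_. 1"] K K1 by simp
  also have "\<dots> \<le> (LBINT x:{-1..1}. K x * K x + 1 / 4)"
  proof (rule set_integral_mono)
    fix x
    show "K x \<le> K x * K x + 1 / 4"
      using zero_le_power2[of "K x - 1 / 2"] by (simp add: power2_eq_square algebra_simps)
  qed (use int in auto)
  also have "\<dots> = (LBINT x. (K x)\<^sup>2) + 1 / 2"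
    using int kernel_moment[of K K] K by (simp add: set_integral_const power2_eq_square)
  finally show ?thesis by simp
qed

theorem theorem3p3:
  fixes M :: "'a measure"
    and N :: "real \<Rightarrow> real \<Rightarrow> 'a \<Rightarrow> nat"
    and W :: "real \<Rightarrow> 'a \<Rightarrow> real"
    and X :: "real \<Rightarrow> real \<Rightarrow> 'a \<Rightarrow> real"
    and lam \<sigma> K b :: "real \<Rightarrow> real"
    and m m' :: nat
    and \<gamma> \<gamma>' u\<^sub>o :: real
  assumes M: "prob_space M"
    and lam_cont: "continuous_on {0..1} lam"
    and lam_nonneg: "\<And>u. u \<in> {0..1} \<Longrightarrow> 0 \<le> lam u"
    and N: "\<And>T. 0 < T \<Longrightarrow> poisson_process M T (\<lambda>t. lam (t / T)) (N T)"
    and W: "brownian_motion M W"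
    and \<sigma>_cont: "continuous_on {0..1} (\<lambda>u. (\<sigma> u)\<^sup>2)"
    and X: "\<And>T. 0 < T \<Longrightarrow> log_price M T \<sigma> (N T) W (X T)"
    and indep: "\<And>T. 0 < T \<Longrightarrow> independent_processes M T (N T) W"
    and m: "m \<in> {0, 1, 2}" and \<gamma>: "0 < \<gamma>" "\<gamma> < 1"
    and \<sigma>_hoelder: "hoelder01 m \<gamma> (\<lambda>u. (\<sigma> u)\<^sup>2)"
    and \<sigma>_bounded: "bounded_away_from_zero01 (\<lambda>u. (\<sigma> u)\<^sup>2)"
    and m': "m' \<in> {0, 1, 2}" and \<gamma>': "0 < \<gamma>'" "\<gamma>' < 1"
    and lam_hoelder: "hoelder01 m' \<gamma>' lam"
    and lam_bounded: "bounded_away_from_zero01 lam"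
    and u\<^sub>o: "0 < u\<^sub>o" "u\<^sub>o < 1"
    and b_0: "(b \<longlongrightarrow> 0) at_top"
    and bT: "filterlim (\<lambda>T. b T * T) at_top at_top"
    and K_cont: "continuous_on UNIV K"
    and K_nonneg: "\<And>x. 0 \<le> K x"
    and K_symmetric: "\<And>x. K (- x) = K x"
    and K_support: "\<And>x. 1 \<le> \<bar>x\<bar> \<Longrightarrow> K x = 0"
    and K_integral: "(LBINT x. K x) = 1"
  shows "let est = (\<lambda>T. intensity_estimator K (b T) T (N T) u\<^sub>o);
             mean = (\<lambda>T. prob_space.expectation M (est T));
             bias = (\<lambda>T. (b T)\<^sup>2 / 2 * deriv01 2 lam u\<^sub>o * (LBINT x. x\<^sup>2 * K x) * of_bool (m' = 2));
             limit = normal_law 0 (lam u\<^sub>o * (LBINT x. (K x)\<^sup>2))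
         in converges_in_probability M est (lam u\<^sub>o) at_top \<and>
            converges_in_distribution M
              (\<lambda>T \<omega>. sqrt (b T * T) * (est T \<omega> - mean T)) limit at_top \<and>
            (((\<lambda>T. b T powr (2 * (real m' + \<gamma>') + 1) * T) \<longlongrightarrow> 0) at_top \<longrightarrow>
               converges_in_probability M
                 (\<lambda>T \<omega>. sqrt (b T * T) * (mean T - lam u\<^sub>o - bias T)) 0 at_top \<and>
               converges_in_distribution M
                 (\<lambda>T \<omega>. sqrt (b T * T) * (est T \<omega> - lam u\<^sub>o - bias T)) limit at_top)"
proof -
  interpret prob_space M by (rule M)
  let ?est = "\<lambda>T. intensity_estimator K (b T) T (N T) u\<^sub>o"
  let ?bias = "\<lambda>T. (b T)\<^sup>2 / 2 * deriv01 2 lam u\<^sub>o * (LBINT x. x\<^sup>2 * K x) * of_bool (m' = 2)"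
  let ?limit = "normal_law 0 (lam u\<^sub>o * (LBINT x. (K x)\<^sup>2))"
  \<comment> \<open>The scaled bias remainder is deterministic. It is the shift fed to the central
    limit theorem, and its smallness in probability reduces to convergence to 0.\<close>
  define c where "c T = sqrt (b T * T) * (expectation (?est T) - lam u\<^sub>o - ?bias T)" for T
  have "0 < lam u\<^sub>o"
    using lam_bounded u\<^sub>o unfolding bounded_away_from_zero01_def
    by (meson atLeastAtMost_iff less_imp_le less_le_trans)
  then have v: "0 < lam u\<^sub>o * (LBINT x. (K x)\<^sup>2)"
    using kernel_square_integral_pos[OF K_cont K_support K_integral] by simp
  have consistent: "converges_in_probability M ?est (lam u\<^sub>o) at_top"
    by (rule intensity_estimator_consistent[OF N lam_cont lam_nonneg u\<^sub>o b_0 bT K_cont K_support K_integral])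
  have clt: "converges_in_distribution M
      (\<lambda>T \<omega>. sqrt (b T * T) * (?est T \<omega> - expectation (?est T)) + c T) ?limit at_top"
    if "(c \<longlongrightarrow> 0) at_top" for c
    by (rule intensity_estimator_clt[OF N lam_cont lam_nonneg u\<^sub>o b_0 bT K_cont K_support v that])
  have c_0: "(c \<longlongrightarrow> 0) at_top" if rate: "((\<lambda>T. b T powr (2 * (real m' + \<gamma>') + 1) * T) \<longlongrightarrow> 0) at_top"
  proof -
    obtain C d where "0 \<le> C" "0 < d" and C: "\<And>b. 0 < b \<Longrightarrow> b < d \<Longrightarrow>
        \<bar>(LBINT x:{-1..1}. lam (u\<^sub>o + b * x) *\<^sub>R K x) - lam u\<^sub>o
          - b\<^sup>2 / 2 * deriv01 2 lam u\<^sub>o * (LBINT x. x\<^sup>2 * K x) * of_bool (m' = 2)\<bar> \<le> C * b powr (real m' + \<gamma>')"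
      using kernel_bias_bound[OF lam_hoelder m' \<gamma>'(1) u\<^sub>o lam_cont K_cont K_nonneg K_symmetric K_support K_integral]
      by blast
    show ?thesis
    proof (rule tendsto_norm_zero_cancel, rule tendsto_sandwich[OF _ _ tendsto_const])
      have "((\<lambda>T. C * sqrt (b T powr (2 * (real m' + \<gamma>') + 1) * T)) \<longlongrightarrow> C * sqrt 0) at_top"
        by (intro tendsto_intros rate)
      then show "((\<lambda>T. C * sqrt (b T powr (2 * (real m' + \<gamma>') + 1) * T)) \<longlongrightarrow> 0) at_top" by simp
      show "\<forall>\<^sub>F T in at_top. norm (c T) \<le> C * sqrt (b T powr (2 * (real m' + \<gamma>') + 1) * T)"
        using eventually_bandwidth[OF u\<^sub>o b_0 bT \<open>0 < d\<close>]
      proof eventually_elim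
        case (elim T)
        then have T: "0 < T" "0 < b T" "b T \<le> u\<^sub>o" "b T \<le> 1 - u\<^sub>o" "b T < d" by auto
        have mean: "expectation (?est T) = (LBINT x:{-1..1}. lam (u\<^sub>o + b T * x) *\<^sub>R K x)"
          by (rule intensity_estimator_moments(2)[OF T(1) N[OF T(1)] T(2-4) lam_cont lam_nonneg K_cont K_support])
        have "norm (c T) \<le> sqrt (b T * T) * (C * b T powr (real m' + \<gamma>'))"
          unfolding c_def mean
          using C[OF T(2,5)] T by (simp add: abs_mult mult_left_mono)
        also have "\<dots> = C * (sqrt (b T * T) * sqrt ((b T powr (real m' + \<gamma>'))\<^sup>2))"
          by simp
        also have "(b T powr (real m' + \<gamma>'))\<^sup>2 = b T powr (2 * (real m' + \<gamma>'))"
          by (simp add: power2_eq_square flip: powr_add)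
        \<comment> \<open>Here the rate condition gets its exponent:
          \<open>2 * (real m' + \<gamma>')\<close> from squaring the bias bound and 1 from the
          variance scale \<open>b T * T\<close>.\<close>
        also have "sqrt (b T * T) * sqrt (b T powr (2 * (real m' + \<gamma>'))) = sqrt (b T powr (2 * (real m' + \<gamma>') + 1) * T)"
          using T by (simp add: powr_add real_sqrt_mult)
        finally show ?case .
      qed
    qed simp
  qed
  have "converges_in_probability M (\<lambda>T \<omega>. c T) 0 at_top" if "(c \<longlongrightarrow> 0) at_top"
  proof (rule converges_in_probability_if_char)
    fix \<theta>
    have "((\<lambda>T. iexp (\<theta> * c T)) \<longlongrightarrow> iexp (\<theta> * 0)) at_top" by (intro tendsto_intros that)
    then show "((\<lambda>T. expectation (\<lambda>\<omega>. iexp (\<theta> * c T))) \<longlongrightarrow> iexp (\<theta> * 0)) at_top"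
      by (simp add: prob_space)
  qed simp
  moreover have "sqrt (b T * T) * (?est T \<omega> - expectation (?est T)) + c T
      = sqrt (b T * T) * (?est T \<omega> - lam u\<^sub>o - ?bias T)" for T \<omega>
    unfolding c_def by (simp add: algebra_simps)
  \<comment> \<open>Shift 0 gives the limit law around the mean, and shift \<open>c\<close> gives
    the one around \<open>lam\<close> at the point plus the bias term.\<close>
  ultimately show ?thesis
    unfolding Let_def using consistent clt[of "\<lambda>_. 0"] clt[of c] c_0
    by (simp add: c_def del: of_bool_eq_iff)
qed

end
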